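(* Let $\rho\geq 1$ be a real number and let $A$ be a $\rho$-contraction on a complex Hilbert space $H$. Then $$\|f(A)\|\leq k_{\rho}\big(|f(0)|\big)$$ for every rational function $f\colon\overline{D}\to\mathbb{C}$ (with poles off $\overline{D}$) satisfying $\|f\|_{\infty}\leq 1$, where $k_{\rho}\colon[0,1]\to[1,\rho]$ is the function $$k_{\rho}(s):=\frac{\rho}{2}(1-s^{2})+\sqrt{\frac{\rho^{2}}{4}(1-s^{2})^{2}+s^{2}},\qquad s\in[0,1].$$
   Context: $D$ is the open unit disk in $\mathbb{C}$ centered at the origin, $\overline{D}$ its closure, and $\|f\|_{\infty}=\sup_{z\in\overline{D}}|f(z)|$. For a bounded operator $A$ on a Hilbert space $H$ and $\rho\geq1$, a unitary $\rho$-dilation of $A$ is a unitary operator $U$ on a Hilbert space $\mathfrak{H}$ containing $H$ as a closed subspace such that $A^{n}x=\rho\,\mathbf{P}U^{n}x$ for all $x\in H$ and $n=1,2,\ldots$, where $\mathbf{P}$ is the orthogonal projection from $\mathfrak{H}$ onto $H$. The operator $A$ is called a $\rho$-contraction if it has a unitary $\rho$-dilation. The spectrum of a $\rho$-contraction is contained in $\overline{D}$, so $f(A)$ is well-defined by the rational functional calculus for every rational function $f$ with poles off $\overline{D}$. $\|f(A)\|$ is the operator norm. *)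

theory Defs
  imports "HOL-Analysis.Analysis" "HOL-Computational_Algebra.Polynomial_Factorial"
    "HOL-Computational_Algebra.Field_as_Ring"
begin

text \<open>
  Complex Hilbert spaces, on top of the norm, topology and completeness classes of HOL-Analysis.
  The inner product is linear in its first argument.  Nonnegativity and definiteness of
  \<open>cinner x x\<close> follow from its being the square of the norm.
\<close>

class complex_inner_space = real_normed_vector +
  fixes scaleC :: "complex \<Rightarrow> 'a \<Rightarrow> 'a" (infixr "*\<^sub>C" 75)
    and cinner :: "'a \<Rightarrow> 'a \<Rightarrow> complex"
  assumes scaleC_add_right: "c *\<^sub>C (x + y) = c *\<^sub>C x + c *\<^sub>C y"
    and scaleC_add_left: "(c + d) *\<^sub>C x = c *\<^sub>C x + d *\<^sub>C x"
    and scaleC_scaleC: "c *\<^sub>C d *\<^sub>C x = (c * d) *\<^sub>C x"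
    and scaleR_eq_scaleC: "r *\<^sub>R x = complex_of_real r *\<^sub>C x"
    and cinner_commute: "cinner x y = cnj (cinner y x)"
    and cinner_add_left: "cinner (x + y) z = cinner x z + cinner y z"
    and cinner_scaleC_left: "cinner (c *\<^sub>C x) y = c * cinner x y"
    and cinner_self: "cinner x x = complex_of_real ((norm x)\<^sup>2)"

class complex_hilbert_space = complex_inner_space + complete_space

subclass (in complex_hilbert_space) banach ..

instantiation complex :: complex_hilbert_space
begin

definition scaleC_complex :: "complex \<Rightarrow> complex \<Rightarrow> complex" where
  "scaleC_complex c x = c * x"

definition cinner_complex :: "complex \<Rightarrow> complex \<Rightarrow> complex" where
  "cinner_complex x y = x * cnj y"

instance
proof
  fix x :: complex
  show "cinner x x = complex_of_real ((norm x)\<^sup>2)"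
    unfolding cinner_complex_def by (rule complex_norm_square [symmetric])
qed (simp_all add: scaleC_complex_def cinner_complex_def algebra_simps scaleR_conv_of_real)

end

definition clinear_map :: "('a::complex_inner_space \<Rightarrow> 'b::complex_inner_space) \<Rightarrow> bool" where
  "clinear_map T \<longleftrightarrow>
     (\<forall>x y. T (x + y) = T x + T y) \<and> (\<forall>c x. T (c *\<^sub>C x) = c *\<^sub>C T x)"

definition bounded_operator :: "('a::complex_inner_space \<Rightarrow> 'b::complex_inner_space) \<Rightarrow> bool" where
  "bounded_operator T \<longleftrightarrow> bounded_linear T \<and> clinear_map T"

definition isometric_embedding ::
    "('a::complex_inner_space \<Rightarrow> 'b::complex_inner_space) \<Rightarrow> bool" where
  "isometric_embedding J \<longleftrightarrow> clinear_map J \<and> (\<forall>x y. cinner (J x) (J y) = cinner x y)"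

definition unitary_operator :: "('a::complex_hilbert_space \<Rightarrow> 'a) \<Rightarrow> bool" where
  "unitary_operator U \<longleftrightarrow>
     bounded_operator U \<and> bij U \<and> (\<forall>x y. cinner (U x) (U y) = cinner x y)"

definition orth_proj :: "'a::complex_hilbert_space set \<Rightarrow> 'a \<Rightarrow> 'a" where
  "orth_proj M y = (THE z. z \<in> M \<and> (\<forall>m\<in>M. cinner (y - z) m = 0))"

text \<open>
  The isometry \<open>J\<close> identifies \<open>'a\<close> with the subspace \<open>range J\<close> of the dilation space \<open>'k\<close>;
  this subspace is closed because \<open>'a\<close> is complete.
\<close>

definition unitary_rho_dilation ::
    "real \<Rightarrow> ('a::complex_hilbert_space \<Rightarrow> 'a) \<Rightarrow> ('a \<Rightarrow> 'k::complex_hilbert_space)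
      \<Rightarrow> ('k \<Rightarrow> 'k) \<Rightarrow> bool" where
  "unitary_rho_dilation \<rho> A J U \<longleftrightarrow>
     isometric_embedding J \<and> unitary_operator U \<and>
     (\<forall>x. \<forall>n\<ge>1. J ((A ^^ n) x) = \<rho> *\<^sub>R orth_proj (range J) ((U ^^ n) (J x)))"

text \<open>
  HOL has no quantifier over types, so the type \<open>'k\<close> of the dilation space is a parameter.
  In a theorem with a hypothesis \<open>rho_contraction TYPE('k) \<rho> A\<close> in which \<open>'k\<close> does not occur
  elsewhere, \<open>'k\<close> is universally quantified, which amounts to an existential quantification
  over dilation spaces in the hypothesis.
\<close>

definition rho_contraction ::
    "'k::complex_hilbert_space itself \<Rightarrow> real \<Rightarrow> ('a::complex_hilbert_space \<Rightarrow> 'a) \<Rightarrow> bool" where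
  "rho_contraction _ \<rho> A \<longleftrightarrow>
     bounded_operator A \<and>
     (\<exists>(J :: 'a \<Rightarrow> 'k) (U :: 'k \<Rightarrow> 'k). unitary_rho_dilation \<rho> A J U)"

text \<open>
  Rational functions are elements of \<open>complex poly fract\<close>.  Numerator and denominator are
  taken in lowest terms, so that the poles are exactly the roots of the denominator.
\<close>

definition rat_num :: "complex poly fract \<Rightarrow> complex poly" where
  "rat_num f = fst (quot_of_fract f)"

definition rat_denom :: "complex poly fract \<Rightarrow> complex poly" where
  "rat_denom f = snd (quot_of_fract f)"

definition rat_poles :: "complex poly fract \<Rightarrow> complex set" where
  "rat_poles f = {z. poly (rat_denom f) z = 0}"

definition rat_eval :: "complex poly fract \<Rightarrow> complex \<Rightarrow> complex" where
  "rat_eval f z = poly (rat_num f) z / poly (rat_denom f) z"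

lemma rat_num_denom_cross:
  assumes "q \<noteq> 0"
  shows "p * rat_denom (Fract p q) = rat_num (Fract p q) * q"
proof -
  have "Fract (rat_num (Fract p q)) (rat_denom (Fract p q)) = Fract p q"
    unfolding rat_num_def rat_denom_def by simp
  moreover have "rat_denom (Fract p q) \<noteq> 0"
    unfolding rat_denom_def by simp
  ultimately show ?thesis
    using assms by (simp add: eq_fract)
qed

lemma rat_denom_Fract_dvd:
  assumes "q \<noteq> 0"
  shows "rat_denom (Fract p q) dvd q"
proof -
  have "coprime (rat_denom (Fract p q)) (rat_num (Fract p q))"
    unfolding rat_num_def rat_denom_def using coprime_quot_of_fract coprime_commute by blast
  moreover have "rat_denom (Fract p q) dvd rat_num (Fract p q) * q"
    by (metis assms rat_num_denom_cross dvd_triv_right)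
  ultimately show ?thesis
    using coprime_dvd_mult_right_iff by blast
qed

lemma rat_eval_Fract:
  assumes "poly q z \<noteq> 0"
  shows "z \<notin> rat_poles (Fract p q)" and "rat_eval (Fract p q) z = poly p z / poly q z"
proof -
  have q: "q \<noteq> 0"
    using assms by auto
  then have d: "poly (rat_denom (Fract p q)) z \<noteq> 0"
    using rat_denom_Fract_dvd[OF q, of p] assms by (metis dvdE mult_zero_left poly_mult)
  then show "z \<notin> rat_poles (Fract p q)"
    by (simp add: rat_poles_def)
  have "poly p z * poly (rat_denom (Fract p q)) z = poly (rat_num (Fract p q)) z * poly q z"
    by (metis poly_mult q rat_num_denom_cross)
  then show "rat_eval (Fract p q) z = poly p z / poly q z"
    using d assms by (simp add: rat_eval_def frac_eq_eq)
qed

definition poly_operator ::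
    "complex poly \<Rightarrow> ('a::complex_hilbert_space \<Rightarrow> 'a) \<Rightarrow> 'a \<Rightarrow> 'a" where
  "poly_operator p A x = (\<Sum>i\<le>degree p. coeff p i *\<^sub>C (A ^^ i) x)"

text \<open>
  The operator \<open>f(A) = p(A) q(A)\<^sup>-\<^sup>1\<close> for \<open>f = p / q\<close>.  It is meaningful when no pole of \<open>f\<close>
  lies in the spectrum of \<open>A\<close>, i.e. when \<open>q(A)\<close> is bijective.
\<close>

definition rat_operator ::
    "complex poly fract \<Rightarrow> ('a::complex_hilbert_space \<Rightarrow> 'a) \<Rightarrow> 'a \<Rightarrow> 'a" where
  "rat_operator f A = poly_operator (rat_num f) A \<circ> inv (poly_operator (rat_denom f) A)"

definition k_rho :: "real \<Rightarrow> real \<Rightarrow> real" where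
  "k_rho \<rho> s = \<rho> / 2 * (1 - s\<^sup>2) + sqrt (\<rho>\<^sup>2 / 4 * (1 - s\<^sup>2)\<^sup>2 + s\<^sup>2)"

lemma k_rho_bounds:
  assumes "\<rho> \<ge> 1" "s \<in> {0..1}"
  shows "k_rho \<rho> s \<in> {1..\<rho>}"
proof -
  define t where "t = 1 - s\<^sup>2"
  have t: "0 \<le> t" "t \<le> 1"
    using assms(2) by (auto simp: t_def power_le_one)
  have s: "s\<^sup>2 = 1 - t"
    by (simp add: t_def)
  have k: "k_rho \<rho> s = \<rho> / 2 * t + sqrt (\<rho>\<^sup>2 / 4 * t\<^sup>2 + (1 - t))"
    by (simp add: k_rho_def s)
  have "(1 - \<rho> / 2 * t)\<^sup>2 \<le> \<rho>\<^sup>2 / 4 * t\<^sup>2 + (1 - t)"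
    using mult_right_mono[OF assms(1) t(1)] by (simp add: power2_eq_square algebra_simps)
  then have lower: "1 - \<rho> / 2 * t \<le> sqrt (\<rho>\<^sup>2 / 4 * t\<^sup>2 + (1 - t))"
    by (rule real_le_rsqrt)
  have "1 \<le> \<rho>\<^sup>2"
    using assms(1) by (simp add: one_le_power)
  then have "1 - t \<le> \<rho>\<^sup>2 * (1 - t)"
    using t mult_right_mono[of 1 "\<rho>\<^sup>2" "1 - t"] by simp
  then have "\<rho>\<^sup>2 / 4 * t\<^sup>2 + (1 - t) \<le> (\<rho> - \<rho> / 2 * t)\<^sup>2"
    by (simp add: power2_eq_square algebra_simps)
  moreover have "0 \<le> \<rho> - \<rho> / 2 * t"
  proof -
    have "\<rho> * t \<le> \<rho> * 1"
      using assms(1) t by (intro mult_left_mono) auto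
    then show ?thesis
      using assms(1) by simp
  qed
  ultimately have upper: "sqrt (\<rho>\<^sup>2 / 4 * t\<^sup>2 + (1 - t)) \<le> \<rho> - \<rho> / 2 * t"
    by (intro real_le_lsqrt) auto
  show ?thesis
    using lower upper by (simp add: k)
qed

end

theory Submission
  imports Defs "HOL-Computational_Algebra.Fundamental_Theorem_Algebra"
begin

text \<open>
  Multiplying \<open>f\<close> by a constant of modulus less than \<open>1\<close>, and letting this modulus tend to \<open>1\<close> at
  the end, reduces the claim to the case \<open>f(0) = s\<close> with \<open>0 \<le> s < 1\<close>.  Write \<open>f = p / q\<close> and put
  \<open>n = p - s q\<close>, \<open>d = q - s p\<close>.  Then \<open>g = n / d = (f - s) / (1 - s f)\<close> maps the disc to itself,
  \<open>g(0) = 0\<close>, and \<open>f = (g + s) / (1 + s g)\<close>.  For \<open>x = d(A) z\<close> and \<open>y = n(A) z = g(A) x\<close> this gives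
  \<open>(1 - s\<^sup>2) p(A) z = y + s x\<close> and \<open>(1 - s\<^sup>2) q(A) z = x + s y\<close>.  Since \<open>q(A)\<close> is surjective, the
  claim becomes \<open>\<parallel>y + s x\<parallel> \<le> k \<parallel>x + s y\<parallel>\<close> with \<open>k = k\<^sub>\<rho>(s)\<close> (\<open>moebius_norm_le\<close>).

  This is proved in the dilation space.  Let \<open>N\<close> be the orthogonal complement of the vectors
  \<open>U\<^bsup>-j\<^esup> J v\<close>, \<open>j \<ge> 1\<close>, and split \<open>J x = x\<^sub>L + x\<^sub>N\<close>, \<open>J y = y\<^sub>L + y\<^sub>N\<close> along \<open>N\<^sup>\<bottom> \<oplus> N\<close>.  The
  vector \<open>\<zeta> = \<rho> g(U) x\<^sub>L\<close> has the following properties.  As \<open>g(0) = 0\<close>, the vectors \<open>g(U) e\<close> with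
  \<open>e \<in> N\<close> are orthogonal to the range of \<open>J\<close>, so \<open>\<zeta>\<close> and \<open>\<rho> g(U) J x\<close> have the same compression, which
  by the dilation property is \<open>g(A) x = y\<close>.  Likewise
  \<open>\<langle>U\<^sup>j \<zeta>, J v\<rangle> = \<langle>A\<^sup>j y, v\<rangle> = \<rho> \<langle>U\<^sup>j y\<^sub>L, J v\<rangle>\<close> for \<open>j \<ge> 1\<close>, so \<open>m = \<zeta> - \<rho> y\<^sub>L\<close> lies in \<open>N\<close>.
  Finally \<open>g(U)\<close> is a contraction by von Neumann's inequality, so
  \<open>\<parallel>m\<parallel>\<^sup>2 + \<rho>\<^sup>2 \<parallel>y\<^sub>L\<parallel>\<^sup>2 = \<parallel>\<zeta>\<parallel>\<^sup>2 \<le> \<rho>\<^sup>2 \<parallel>x\<^sub>L\<parallel>\<^sup>2\<close>.  Pairing \<open>\<zeta>\<close> with \<open>J x\<close> and \<open>J y\<close>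
  yields two linear relations between the inner products of \<open>x\<^sub>L\<close>, \<open>y\<^sub>L\<close>, \<open>x\<^sub>N\<close>, \<open>y\<^sub>N\<close> and \<open>m\<close>.

  These relations suffice.  With \<open>k\<^sup>2 - s\<^sup>2 = \<rho> (1 - s\<^sup>2) k\<close>, the defining equation of \<open>k\<close>, they turn
  \<open>k\<^sup>2 \<parallel>x + s y\<parallel>\<^sup>2 - \<parallel>y + s x\<parallel>\<^sup>2\<close> into a sum of nonnegative terms (\<open>gram_inequality\<close>).
  The coefficients of that sum are found from the extremal case: for \<open>f(z) = (z + s) / (1 + s z)\<close> and
  \<open>A\<close> the \<open>2 \<times> 2\<close> Jordan block with off-diagonal entry \<open>\<rho>\<close>, the matrix \<open>f(A)\<close> has diagonal entries
  \<open>s\<close> and off-diagonal entry \<open>\<rho> (1 - s\<^sup>2)\<close>, its norm is exactly \<open>k\<close>, and every term of the sum must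
  vanish at a vector where this norm is attained.
\<close>

section \<open>Geometry of complex Hilbert spaces\<close>

lemma scaleC_one [simp]: "1 *\<^sub>C x = (x :: 'a::complex_inner_space)"
  using scaleR_eq_scaleC [of 1 x] by simp

lemma scaleC_zero_left [simp]: "0 *\<^sub>C x = (0 :: 'a::complex_inner_space)"
  using scaleR_eq_scaleC [of 0 x] by simp

lemma scaleC_zero_right [simp]: "c *\<^sub>C (0 :: 'a::complex_inner_space) = 0"
  using scaleC_add_right [of c 0 0] by simp

lemma scaleC_minus_right: "c *\<^sub>C (- x) = - (c *\<^sub>C (x :: 'a::complex_inner_space))"
  using scaleC_add_right [of c x "- x"] by (simp add: eq_neg_iff_add_eq_0 add.commute)

lemma scaleC_minus_left: "(- c) *\<^sub>C x = - (c *\<^sub>C (x :: 'a::complex_inner_space))"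
  using scaleC_add_left [of c "- c" x] by (simp add: eq_neg_iff_add_eq_0 add.commute)

lemma scaleC_diff_right: "c *\<^sub>C (x - y) = c *\<^sub>C x - c *\<^sub>C (y :: 'a::complex_inner_space)"
  using scaleC_add_right [of c x "- y"] by (simp add: scaleC_minus_right)

lemma scaleC_sum_right:
  "c *\<^sub>C (\<Sum>i\<in>I. f i) = (\<Sum>i\<in>I. c *\<^sub>C (f i :: 'a::complex_inner_space))"
  by (induction I rule: infinite_finite_induct) (auto simp: scaleC_add_right)

lemma cinner_add_right: "cinner x (y + z) = cinner x y + cinner x (z :: 'a::complex_inner_space)"
  by (subst (1 2 3) cinner_commute) (simp add: cinner_add_left)

lemma cinner_scaleC_right:
  "cinner x (c *\<^sub>C y) = cnj c * cinner x (y :: 'a::complex_inner_space)"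
  by (subst (1 2) cinner_commute) (simp add: cinner_scaleC_left)

lemma cinner_zero_left [simp]: "cinner 0 (x :: 'a::complex_inner_space) = 0"
  using cinner_add_left [of 0 0 x] by simp

lemma cinner_zero_right [simp]: "cinner (x :: 'a::complex_inner_space) 0 = 0"
  using cinner_add_right [of x 0 0] by simp

lemma cinner_minus_left: "cinner (- x) y = - cinner x (y :: 'a::complex_inner_space)"
  using cinner_add_left [of x "- x" y] by (simp add: eq_neg_iff_add_eq_0 add.commute)

lemma cinner_minus_right: "cinner x (- y) = - cinner x (y :: 'a::complex_inner_space)"
  using cinner_add_right [of x y "- y"] by (simp add: eq_neg_iff_add_eq_0 add.commute)

lemma cinner_diff_left: "cinner (x - y) z = cinner x z - cinner y (z :: 'a::complex_inner_space)"
  using cinner_add_left [of x "- y" z] by (simp add: cinner_minus_left)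

lemma cinner_diff_right: "cinner x (y - z) = cinner x y - cinner x (z :: 'a::complex_inner_space)"
  using cinner_add_right [of x y "- z"] by (simp add: cinner_minus_right)

lemma cinner_scaleR_left: "cinner (r *\<^sub>R x) y = r * cinner x (y :: 'a::complex_inner_space)"
  by (simp add: scaleR_eq_scaleC cinner_scaleC_left)

lemma cinner_scaleR_right: "cinner x (r *\<^sub>R y) = r * cinner x (y :: 'a::complex_inner_space)"
  by (simp add: scaleR_eq_scaleC cinner_scaleC_right)

lemma cinner_sum_left:
  "cinner (\<Sum>i\<in>I. f i) y = (\<Sum>i\<in>I. cinner (f i) (y :: 'a::complex_inner_space))"
  by (induction I rule: infinite_finite_induct) (auto simp: cinner_add_left)

lemma cinner_sum_right:
  "cinner y (\<Sum>i\<in>I. f i) = (\<Sum>i\<in>I. cinner y (f i :: 'a::complex_inner_space))"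
  by (induction I rule: infinite_finite_induct) (auto simp: cinner_add_right)

lemma Re_cinner_commute: "Re (cinner x y) = Re (cinner y (x :: 'a::complex_inner_space))"
  by (subst cinner_commute) simp

lemma cinner_eq_zero_commute: "cinner x y = 0 \<longleftrightarrow> cinner y (x :: 'a::complex_inner_space) = 0"
  by (subst cinner_commute) simp

lemma norm_square_eq_cinner: "(norm (x :: 'a::complex_inner_space))\<^sup>2 = Re (cinner x x)"
  by (simp add: cinner_self)

lemma norm_add_square:
  "(norm (x + y :: 'a::complex_inner_space))\<^sup>2 = (norm x)\<^sup>2 + (norm y)\<^sup>2 + 2 * Re (cinner x y)"
  unfolding norm_square_eq_cinner
  by (simp add: cinner_add_left cinner_add_right Re_cinner_commute [of y x])

lemma norm_scaleC [simp]: "norm (c *\<^sub>C (x :: 'a::complex_inner_space)) = cmod c * norm x"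
proof -
  have "complex_of_real ((norm (c *\<^sub>C x))\<^sup>2) = complex_of_real ((cmod c * norm x)\<^sup>2)"
    unfolding cinner_self [symmetric] cinner_scaleC_left cinner_scaleC_right
    unfolding cinner_self power_mult_distrib of_real_mult complex_norm_square [of c] by simp
  then have "(norm (c *\<^sub>C x))\<^sup>2 = (cmod c * norm x)\<^sup>2"
    by (simp only: of_real_eq_iff)
  then show ?thesis
    by simp
qed

text \<open>
  Nonnegativity of the left-hand side is the Cauchy-Schwarz inequality; minimality of \<open>\<parallel>w\<parallel>\<close> along
  the line \<open>w - c m\<close> forces \<open>\<langle>w, m\<rangle> = 0\<close>, which gives orthogonal projections.
\<close>

lemma norm_diff_orthogonal_component:
  fixes w m :: "'a::complex_inner_space"
  assumes "m \<noteq> 0"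
  shows "(norm (w - (cinner w m / (norm m)\<^sup>2) *\<^sub>C m))\<^sup>2
    = (norm w)\<^sup>2 - (cmod (cinner w m))\<^sup>2 / (norm m)\<^sup>2"
proof -
  define c where "c = cinner w m / (norm m)\<^sup>2"
  have nm: "(norm m)\<^sup>2 \<noteq> 0"
    using assms by simp
  have "Re (cinner w (- (c *\<^sub>C m))) = - ((cmod (cinner w m))\<^sup>2 / (norm m)\<^sup>2)"
  proof -
    have "cnj c * cinner w m = cinner w m * cnj (cinner w m) / (norm m)\<^sup>2"
      by (simp add: c_def)
    also have "\<dots> = complex_of_real ((cmod (cinner w m))\<^sup>2 / (norm m)\<^sup>2)"
      by (simp only: complex_norm_square [symmetric] of_real_divide)
    finally show ?thesis
      by (simp add: cinner_minus_right cinner_scaleC_right)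
  qed
  moreover have "(norm (- (c *\<^sub>C m)))\<^sup>2 = (cmod (cinner w m))\<^sup>2 / (norm m)\<^sup>2"
  proof -
    have "cmod c = cmod (cinner w m) / (norm m)\<^sup>2"
      unfolding c_def norm_divide by (simp add: norm_power)
    then show ?thesis
      using nm by (simp add: power_mult_distrib power_divide power2_eq_square field_simps)
  qed
  ultimately show ?thesis
    using norm_add_square [of w "- (c *\<^sub>C m)"] unfolding c_def [symmetric] by simp
qed

lemma Cauchy_Schwarz_cinner: "cmod (cinner x y) \<le> norm x * norm (y :: 'a::complex_inner_space)"
proof (cases "y = 0")
  case False
  have "0 \<le> (norm x)\<^sup>2 - (cmod (cinner x y))\<^sup>2 / (norm y)\<^sup>2"
    unfolding norm_diff_orthogonal_component [OF False, symmetric] by simp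
  then have "(cmod (cinner x y))\<^sup>2 \<le> (norm x * norm y)\<^sup>2"
    using False by (simp add: divide_le_eq power_mult_distrib)
  then show ?thesis
    by (simp add: power2_le_iff_abs_le)
qed simp

lemma bounded_linear_scaleC: "bounded_linear (\<lambda>x :: 'a::complex_inner_space. c *\<^sub>C x)"
  by (rule bounded_linear_intro [where K = "cmod c"])
    (simp_all add: scaleC_add_right scaleR_eq_scaleC scaleC_scaleC mult.commute)

lemma bounded_linear_cinner_left: "bounded_linear (\<lambda>x :: 'a::complex_inner_space. cinner x y)"
  by (rule bounded_linear_intro [where K = "norm y"])
    (simp_all add: cinner_add_left cinner_scaleR_left Cauchy_Schwarz_cinner scaleR_conv_of_real)

text \<open>
  A minimising sequence in the subspace is Cauchy by the parallelogram law; at the nearest point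
  the residual has no component along the subspace, since removing one would shorten it.
\<close>

lemma orthogonal_projection_exists:
  fixes M :: "'a::complex_hilbert_space set"
  assumes closed: "closed M" and zero: "0 \<in> M"
    and add: "\<And>x y. x \<in> M \<Longrightarrow> y \<in> M \<Longrightarrow> x + y \<in> M"
    and scale: "\<And>c x. x \<in> M \<Longrightarrow> c *\<^sub>C x \<in> M"
  shows "\<exists>z\<in>M. \<forall>m\<in>M. cinner (y - z) m = 0"
proof -
  define \<delta> where "\<delta> = infdist y M"
  have \<delta>_le: "\<delta> \<le> norm (y - m)" if "m \<in> M" for m
    using infdist_le [OF that, of y] by (simp add: \<delta>_def dist_norm)
  have \<delta>_nonneg: "0 \<le> \<delta>"
    by (simp add: \<delta>_def infdist_nonneg)
  have "\<exists>m\<in>M. norm (y - m) < \<delta> + 1 / Suc n" for n :: nat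
  proof (rule ccontr)
    assume "\<not> ?thesis"
    then have "\<delta> + 1 / Suc n \<le> dist y m" if "m \<in> M" for m
      using that by (force simp: dist_norm not_less)
    then have "\<delta> + 1 / Suc n \<le> infdist y M"
      using zero by (auto simp: infdist_def intro!: cINF_greatest)
    then show False
      by (simp add: \<delta>_def)
  qed
  then obtain u where u: "\<And>n. u n \<in> M" and u_near: "\<And>n. norm (y - u n) < \<delta> + 1 / Suc n"
    by metis
  have parallelogram: "(norm (u i - u j))\<^sup>2
      \<le> 2 * (norm (y - u i))\<^sup>2 + 2 * (norm (y - u j))\<^sup>2 - 4 * \<delta>\<^sup>2" for i j
  proof -
    let ?a = "y - u i" and ?b = "y - u j"
    have mid: "(1/2) *\<^sub>C (u i + u j) \<in> M"
      by (intro scale add u)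
    have "(1/2) *\<^sub>C (?a + ?b) = y - (1/2) *\<^sub>C (u i + u j)"
    proof -
      have "(1/2) *\<^sub>C (y + y) = y"
        unfolding scaleC_add_right scaleC_add_left [symmetric] by simp
      then show ?thesis
        by (simp add: scaleC_diff_right scaleC_add_right algebra_simps)
    qed
    then have "norm (?a + ?b) / 2 = norm (y - (1/2) *\<^sub>C (u i + u j))"
      using norm_scaleC [of "1/2" "?a + ?b"] by (simp add: norm_divide)
    then have "2 * \<delta> \<le> norm (?a + ?b)"
      using \<delta>_le [OF mid] by simp
    then have "(2 * \<delta>)\<^sup>2 \<le> (norm (?a + ?b))\<^sup>2"
      using \<delta>_nonneg by (intro power_mono) auto
    moreover have "(norm (u i - u j))\<^sup>2 = (norm ?a)\<^sup>2 + (norm ?b)\<^sup>2 - 2 * Re (cinner ?a ?b)"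
    proof -
      have "u i - u j = ?b + - ?a"
        by simp
      then have "(norm (u i - u j))\<^sup>2 = (norm (?b + - ?a))\<^sup>2"
        by (rule arg_cong)
      also have "\<dots> = (norm ?b)\<^sup>2 + (norm ?a)\<^sup>2 - 2 * Re (cinner ?b ?a)"
        unfolding norm_add_square norm_minus_cancel cinner_minus_right by simp
      finally show ?thesis
        by (simp only: Re_cinner_commute [of ?b ?a] add.commute)
    qed
    ultimately show ?thesis
      using norm_add_square [of ?a ?b] by (simp add: power_mult_distrib)
  qed
  have "Cauchy u"
  proof (rule metric_CauchyI)
    fix e :: real
    assume e: "0 < e"
    have "(\<lambda>n. 4 * (\<delta> + 1 / Suc n)\<^sup>2 - 4 * \<delta>\<^sup>2) \<longlonglongrightarrow> 4 * (\<delta> + 0)\<^sup>2 - 4 * \<delta>\<^sup>2"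
      by (intro tendsto_intros LIMSEQ_Suc [OF lim_1_over_n])
    then have "\<forall>\<^sub>F n in sequentially. 4 * (\<delta> + 1 / Suc n)\<^sup>2 - 4 * \<delta>\<^sup>2 < e\<^sup>2"
      using e by (intro order_tendstoD(2)) auto
    then obtain n0 where n0: "4 * (\<delta> + 1 / Suc n0)\<^sup>2 - 4 * \<delta>\<^sup>2 < e\<^sup>2"
      by (auto simp: eventually_sequentially)
    have near: "(norm (y - u i))\<^sup>2 \<le> (\<delta> + 1 / Suc n0)\<^sup>2" if "n0 \<le> i" for i
    proof -
      have "1 / real (Suc i) \<le> 1 / Suc n0"
        using that by (simp add: frac_le)
      then show ?thesis
        using u_near [of i] by (intro power_mono) auto
    qed
    have "dist (u i) (u j) < e" if "n0 \<le> i" "n0 \<le> j" for i j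
    proof -
      have "(norm (u i - u j))\<^sup>2 < e\<^sup>2"
        using parallelogram [of i j] near [OF that(1)] near [OF that(2)] n0 by simp
      then show ?thesis
        using e by (simp add: dist_norm power_less_imp_less_base)
    qed
    then show "\<exists>n. \<forall>i\<ge>n. \<forall>j\<ge>n. dist (u i) (u j) < e"
      by blast
  qed
  then obtain z where z: "u \<longlonglongrightarrow> z"
    using Cauchy_convergent_iff convergent_def by blast
  have zM: "z \<in> M"
    using closed_sequentially [OF closed u z] .
  have "norm (y - z) \<le> \<delta> + 0"
  proof (rule LIMSEQ_le)
    show "(\<lambda>n. norm (y - u n)) \<longlonglongrightarrow> norm (y - z)"
      by (intro tendsto_intros z)
    show "(\<lambda>n. \<delta> + 1 / Suc n) \<longlonglongrightarrow> \<delta> + 0"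
      by (intro tendsto_intros LIMSEQ_Suc [OF lim_1_over_n])
    show "\<exists>n0. \<forall>n\<ge>n0. norm (y - u n) \<le> \<delta> + 1 / Suc n"
      using u_near less_imp_le by blast
  qed
  then have minimal: "norm (y - z) \<le> norm (y - m)" if "m \<in> M" for m
    using \<delta>_le [OF that] by simp
  have "cinner (y - z) m = 0" if m: "m \<in> M" for m
  proof (cases "m = 0")
    case False
    let ?c = "cinner (y - z) m / (norm m)\<^sup>2"
    have "z + ?c *\<^sub>C m \<in> M"
      by (intro add scale zM m)
    then have "(norm (y - z))\<^sup>2 \<le> (norm (y - z - ?c *\<^sub>C m))\<^sup>2"
      using minimal by (intro power_mono) (auto simp: diff_diff_eq)
    then have "(cmod (cinner (y - z) m))\<^sup>2 / (norm m)\<^sup>2 \<le> 0"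
      unfolding norm_diff_orthogonal_component [OF False] by simp
    then show ?thesis
      using False by (simp add: divide_le_0_iff)
  qed simp
  then show ?thesis
    using zM by blast
qed

lemma orth_proj_orthogonal:
  fixes M :: "'a::complex_hilbert_space set"
  assumes "closed M" "0 \<in> M"
    and "\<And>x y. x \<in> M \<Longrightarrow> y \<in> M \<Longrightarrow> x + y \<in> M"
    and "\<And>c x. x \<in> M \<Longrightarrow> c *\<^sub>C x \<in> M"
    and "m \<in> M"
  shows "cinner (y - orth_proj M y) m = 0"
proof -
  obtain z where z: "z \<in> M" "\<forall>m\<in>M. cinner (y - z) m = 0"
    using orthogonal_projection_exists [OF assms(1-4)] by blast
  have "z' = z" if z': "z' \<in> M" "\<forall>m\<in>M. cinner (y - z') m = 0" for z'
  proof -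
    have "z' + (- 1) *\<^sub>C z \<in> M"
      using z z' assms(3,4) by blast
    then have diff: "z' - z \<in> M"
      by (simp add: scaleC_minus_left)
    have "cinner (z' - z) (z' - z) = cinner (y - z) (z' - z) - cinner (y - z') (z' - z)"
      by (simp add: cinner_diff_left)
    also have "\<dots> = 0"
      using z z' diff by simp
    finally show ?thesis
      by (simp add: cinner_self)
  qed
  then have "\<exists>!z. z \<in> M \<and> (\<forall>m\<in>M. cinner (y - z) m = 0)"
    using z by blast
  then show ?thesis
    unfolding orth_proj_def using theI' [of "\<lambda>z. z \<in> M \<and> (\<forall>m\<in>M. cinner (y - z) m = 0)"] assms(5)
    by blast
qed

lemma isometric_embedding_norm:
  "isometric_embedding J \<Longrightarrow> norm (J x) = norm x"
proof -
  assume "isometric_embedding J"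
  then have "(norm (J x))\<^sup>2 = (norm x)\<^sup>2"
    by (simp add: isometric_embedding_def norm_square_eq_cinner)
  then show ?thesis
    by simp
qed

lemma clinear_mapD:
  assumes "clinear_map T"
  shows clinear_map_add: "T (x + y) = T x + T y"
    and clinear_map_scaleC: "T (c *\<^sub>C x) = c *\<^sub>C T x"
    and clinear_map_zero: "T 0 = 0"
    and clinear_map_diff: "T (x - y) = T x - T y"
    and clinear_map_sum: "T (\<Sum>i\<in>I. g i) = (\<Sum>i\<in>I. T (g i))"
proof -
  show add: "T (x + y) = T x + T y" and scale: "T (c *\<^sub>C x) = c *\<^sub>C T x" for x y c
    using assms by (auto simp: clinear_map_def)
  show zero: "T 0 = 0"
    using scale [of 0 0] by simp
  show "T (x - y) = T x - T y"
    using add [of "x - y" y] by simp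
  show "T (\<Sum>i\<in>I. g i) = (\<Sum>i\<in>I. T (g i))"
    by (induction I rule: infinite_finite_induct) (auto simp: add zero)
qed

lemma clinear_map_funpow:
  fixes T :: "'a::complex_inner_space \<Rightarrow> 'a"
  shows "clinear_map T \<Longrightarrow> clinear_map (T ^^ n)"
  by (induction n) (auto simp: clinear_map_def)

text \<open>
  A limit point of the range is the image of the limit of the preimages, which form a Cauchy sequence
  because distances are preserved.
\<close>

lemma range_isometric_embedding_closed:
  fixes J :: "'a::complex_hilbert_space \<Rightarrow> 'k::complex_hilbert_space"
  assumes J: "isometric_embedding J"
  shows "closed (range J)"
proof (unfold closed_sequential_limits)
  show "\<forall>x l. (\<forall>n. x n \<in> range J) \<and> x \<longlonglongrightarrow> l \<longrightarrow> l \<in> range J"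
  proof (intro allI impI, elim conjE)
    fix x l
    assume "\<forall>n. x n \<in> range J" and lim: "x \<longlonglongrightarrow> l"
    then have "\<forall>n. \<exists>v. x n = J v"
      by blast
    then obtain u where u: "\<And>n. x n = J (u n)"
      by metis
    have x: "x = (\<lambda>n. J (u n))"
      using u by blast
    have lin: "clinear_map J"
      using J by (simp add: isometric_embedding_def)
    have dist: "dist (J a) (J b) = dist a b" for a b
      by (simp add: dist_norm isometric_embedding_norm [OF J] flip: clinear_map_diff [OF lin])
    have limJ: "(\<lambda>n. J (u n)) \<longlonglongrightarrow> l"
      using lim unfolding x .
    then have "Cauchy (\<lambda>n. J (u n))"
      by (rule LIMSEQ_imp_Cauchy)
    then have "Cauchy u"
      by (simp add: Cauchy_def dist)
    then obtain v where v: "u \<longlonglongrightarrow> v"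
      using Cauchy_convergent_iff convergent_def by blast
    then have "(\<lambda>n. J (u n)) \<longlonglongrightarrow> J v"
      by (simp add: tendsto_iff dist)
    then show "l \<in> range J"
      using LIMSEQ_unique [OF limJ] by blast
  qed
qed

section \<open>Polynomials without zeros in the closed unit disc\<close>

lemma no_roots_in_disc_induct [consumes 1, case_names const factor]:
  fixes p :: "complex poly"
  assumes "\<forall>z\<in>cball 0 1. poly p z \<noteq> 0"
    and const: "\<And>c. c \<noteq> 0 \<Longrightarrow> P [:c:]"
    and factor: "\<And>\<mu> p. 1 < cmod \<mu> \<Longrightarrow> P p \<Longrightarrow> P ([:- \<mu>, 1:] * p)"
  shows "P p"
  using assms(1)
proof (induction "degree p" arbitrary: p rule: less_induct)
  case less
  show ?case
  proof (cases "degree p = 0")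
    case True
    then obtain c where "p = [:c:]"
      using degree_eq_zeroE by blast
    then show ?thesis
      using bspec [OF less.prems, of 0] const [of c] by auto
  next
    case False
    then have "\<not> constant (poly p)"
      by (simp add: constant_degree)
    then obtain \<mu> where \<mu>: "poly p \<mu> = 0"
      using fundamental_theorem_of_algebra by blast
    then obtain r where r: "p = [:- \<mu>, 1:] * r"
      by (auto simp: poly_eq_0_iff_dvd elim: dvdE)
    have "r \<noteq> 0"
      using r False by auto
    then have "degree r < degree p"
      unfolding r by (subst degree_mult_eq) auto
    moreover have "\<forall>z\<in>cball 0 1. poly r z \<noteq> 0"
      using less.prems r by auto
    ultimately have "P r"
      using less.hyps by blast
    moreover have "1 < cmod \<mu>"
      using less.prems \<mu> by force
    ultimately show ?thesis
      unfolding r using factor by blast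
  qed
qed

text \<open>
  Along a factor \<open>X - \<mu>\<close> of \<open>d\<close> the values \<open>\<phi> (X\<^sup>j q)\<close> form a geometric progression of ratio
  \<open>\<mu>\<close>.  For \<open>\<bar>\<mu>\<bar> > 1\<close> it can be bounded only if it vanishes.  This replaces the expansion of
  \<open>1 / d\<close> in a power series.
\<close>

lemma bounded_functional_vanishing_on_ideal:
  fixes \<phi> :: "complex poly \<Rightarrow> complex"
  assumes "\<forall>z\<in>cball 0 1. poly d z \<noteq> 0"
    and add: "\<And>p q. \<phi> (p + q) = \<phi> p + \<phi> q"
    and smult: "\<And>c p. \<phi> (smult c p) = c * \<phi> p"
    and bounded: "\<And>p. \<exists>C. \<forall>j. cmod (\<phi> (monom 1 j * p)) \<le> C"
    and "\<And>p. \<phi> (d * p) = 0"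
  shows "\<phi> p = 0"
proof -
  have "(\<forall>p. \<phi> (d * p) = 0) \<longrightarrow> (\<forall>p. \<phi> p = 0)"
    using assms(1)
  proof (induction d rule: no_roots_in_disc_induct)
    case (const c)
    then show ?case
      by (simp add: smult)
  next
    case (factor \<mu> d)
    have "\<phi> (d * p) = 0" if zero: "\<forall>p. \<phi> ([:- \<mu>, 1:] * d * p) = 0" for p
    proof -
      define b where "b j = \<phi> (monom 1 j * (d * p))" for j
      have "b (Suc j) = \<mu> * b j" for j
      proof -
        have "monom 1 (Suc j) * (d * p)
            = [:- \<mu>, 1:] * d * (monom 1 j * p) + smult \<mu> (monom 1 j * (d * p))"
          by (simp add: monom_Suc algebra_simps)
        then show ?thesis
          unfolding b_def using zero by (simp only: add smult) simp
      qed
      then have b: "b j = \<mu> ^ j * b 0" for j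
        by (induction j) auto
      obtain C where C: "\<And>j. cmod (b j) \<le> C"
        using bounded [of "d * p"] by (auto simp: b_def)
      have "b 0 = 0"
      proof (rule ccontr)
        assume "b 0 \<noteq> 0"
        obtain j where "C / cmod (b 0) < cmod \<mu> ^ j"
          using real_arch_pow [OF factor(1)] by blast
        then have "C < cmod (b j)"
          using \<open>b 0 \<noteq> 0\<close> unfolding b [of j] by (simp add: norm_mult norm_power field_simps)
        then show False
          using C [of j] by simp
      qed
      then show ?thesis
        by (simp add: b_def)
    qed
    then show ?case
      using factor(2) by blast
  qed
  then show ?thesis
    using assms(5) by blast
qed

section \<open>Polynomials of an operator\<close>

lemma poly_operator_eq_sum:
  "degree p \<le> n \<Longrightarrow> poly_operator p T x = (\<Sum>i\<le>n. coeff p i *\<^sub>C (T ^^ i) x)"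
  unfolding poly_operator_def by (rule sum.mono_neutral_left) (auto simp: coeff_eq_0)

lemma poly_operator_0 [simp]: "poly_operator 0 T x = 0"
  by (simp add: poly_operator_def)

lemma poly_operator_pCons:
  assumes "clinear_map T"
  shows "poly_operator (pCons c p) T x = c *\<^sub>C x + T (poly_operator p T x)"
proof -
  have "poly_operator (pCons c p) T x
      = (\<Sum>i\<le>Suc (degree p). coeff (pCons c p) i *\<^sub>C (T ^^ i) x)"
    by (rule poly_operator_eq_sum) (simp add: degree_pCons_le)
  also have "\<dots> = c *\<^sub>C x + (\<Sum>i\<le>degree p. coeff p i *\<^sub>C T ((T ^^ i) x))"
    by (subst sum.atMost_Suc_shift) simp
  finally show ?thesis
    by (simp add: poly_operator_def clinear_map_sum [OF assms] clinear_map_scaleC [OF assms])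
qed

lemma poly_operator_const [simp]:
  "poly_operator [:c:] T x = c *\<^sub>C x"
  by (simp add: poly_operator_def)

lemma poly_operator_add:
  "poly_operator (p + q) T x = poly_operator p T x + poly_operator q T x"
proof -
  let ?n = "max (degree p) (degree q)"
  have "degree (p + q) \<le> ?n"
    by (rule degree_add_le_max)
  then show ?thesis
    by (simp add: poly_operator_eq_sum [of _ ?n] sum.distrib scaleC_add_left)
qed

lemma poly_operator_smult: "poly_operator (smult c p) T x = c *\<^sub>C poly_operator p T x"
  by (simp add: poly_operator_eq_sum [of _ "degree p"] degree_smult_le scaleC_sum_right
      scaleC_scaleC)

lemma clinear_map_poly_operator:
  assumes "clinear_map T"
  shows "clinear_map (poly_operator p T)"
proof (induction p)
  case (pCons c p)
  then show ?case
    using assms unfolding clinear_map_def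
    by (simp add: poly_operator_pCons [OF assms] scaleC_add_right scaleC_scaleC mult.commute
        add.assoc add.left_commute)
qed (simp add: clinear_map_def)

lemma poly_operator_mult:
  assumes "clinear_map T"
  shows "poly_operator (p * q) T x = poly_operator p T (poly_operator q T x)"
  by (induction p)
    (simp_all add: poly_operator_add poly_operator_smult poly_operator_pCons [OF assms])

lemma poly_operator_monom_mult:
  assumes "clinear_map T"
  shows "poly_operator (monom 1 n * p) T x = (T ^^ n) (poly_operator p T x)"
proof (induction n)
  case (Suc n)
  have "monom 1 (Suc n) * p = pCons 0 (monom 1 n * p)"
    by (simp add: monom_Suc)
  then show ?case
    using Suc by (simp add: poly_operator_pCons [OF assms])
qed simp

lemma poly_operator_funpow:
  assumes "clinear_map T"
  shows "poly_operator p T ((T ^^ n) x) = (T ^^ n) (poly_operator p T x)"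
  using poly_operator_mult [OF assms, of p "monom 1 n" x] poly_operator_monom_mult [OF assms, of n p x]
    poly_operator_monom_mult [OF assms, of n 1 x]
  by (simp add: mult.commute one_pCons)

text \<open>
  The solution of \<open>T x - \<mu> x = y\<close> is given by the Neumann series, whose terms are dominated by a
  geometric series because the powers of \<open>T\<close> are bounded and \<open>\<bar>\<mu>\<bar> > 1\<close>.
\<close>

lemma power_bounded_minus_scalar_surj:
  fixes T :: "'a::complex_hilbert_space \<Rightarrow> 'a"
  assumes T: "bounded_operator T"
    and power_bounded: "\<And>n x. norm ((T ^^ n) x) \<le> C * norm x"
    and \<mu>: "1 < cmod \<mu>"
  shows "\<exists>x. T x - \<mu> *\<^sub>C x = y"
proof -
  have lin: "clinear_map T" and bounded: "bounded_linear T"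
    using T by (auto simp: bounded_operator_def)
  have [simp]: "\<mu> \<noteq> 0"
    using \<mu> by auto
  define a where "a n = (inverse \<mu> ^ Suc n) *\<^sub>C (T ^^ n) y" for n
  have summable: "summable a"
  proof (rule summable_comparison_test')
    show "summable (\<lambda>n. C * norm y * (1 / cmod \<mu>) * (1 / cmod \<mu>) ^ n)"
      using \<mu> by (intro summable_mult summable_geometric) (simp add: norm_divide)
    show "norm (a n) \<le> C * norm y * (1 / cmod \<mu>) * (1 / cmod \<mu>) ^ n" for n
    proof -
      have "norm (a n) = (1 / cmod \<mu>) ^ Suc n * norm ((T ^^ n) y)"
        by (simp only: a_def norm_scaleC norm_power norm_inverse inverse_eq_divide [symmetric])
      also have "\<dots> \<le> (1 / cmod \<mu>) ^ Suc n * (C * norm y)"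
        by (intro mult_left_mono power_bounded) simp
      finally show ?thesis
        by (simp add: mult_ac)
    qed
  qed
  have step: "T (a n) = \<mu> *\<^sub>C a (Suc n)" for n
    by (simp add: a_def clinear_map_scaleC [OF lin] scaleC_scaleC flip: mult.assoc)
  have "T (suminf a) = (\<Sum>n. T (a n))"
    by (rule bounded_linear.suminf [OF bounded summable])
  also have "\<dots> = \<mu> *\<^sub>C (\<Sum>n. a (Suc n))"
    unfolding step using summable
    by (intro bounded_linear.suminf [OF bounded_linear_scaleC, symmetric]) (simp add: summable_Suc_iff)
  also have "\<dots> = \<mu> *\<^sub>C suminf a - y"
    using suminf_split_head [OF summable] by (simp add: scaleC_diff_right a_def scaleC_scaleC)
  finally have "T (- suminf a) - \<mu> *\<^sub>C (- suminf a) = y"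
    using clinear_map_diff [OF lin, of 0 "suminf a"] clinear_map_zero [OF lin]
    by (simp add: scaleC_minus_right)
  then show ?thesis
    by blast
qed

text \<open>
  A polynomial without zeros in the closed disc is a product of factors \<open>X - \<mu>\<close> with \<open>\<bar>\<mu>\<bar> > 1\<close>, each
  of which gives a surjective operator.  A denominator \<open>q(A)\<close> is eliminated by writing a vector as \<open>q(A) z\<close>.
\<close>

lemma power_bounded_poly_operator_surj:
  fixes T :: "'a::complex_hilbert_space \<Rightarrow> 'a"
  assumes T: "bounded_operator T"
    and power_bounded: "\<And>n x. norm ((T ^^ n) x) \<le> C * norm x"
    and "\<forall>z\<in>cball 0 1. poly q z \<noteq> 0"
  shows "surj (poly_operator q T)"
  using assms(3)
proof (induction q rule: no_roots_in_disc_induct)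
  case (const c)
  then have "poly_operator [:c:] T (inverse c *\<^sub>C y) = y" for y
    by (simp add: scaleC_scaleC)
  then show ?case
    by (rule surjI)
next
  case (factor \<mu> q)
  have lin: "clinear_map T"
    using T by (simp add: bounded_operator_def)
  have "\<exists>x. poly_operator ([:- \<mu>, 1:] * q) T x = y" for y
  proof -
    obtain v where v: "T v - \<mu> *\<^sub>C v = y"
      using power_bounded_minus_scalar_surj [OF T power_bounded factor(1)] by blast
    obtain x where x: "v = poly_operator q T x"
      using factor(2) by (meson surjD)
    have "poly_operator ([:- \<mu>, 1:] * q) T x = T v - \<mu> *\<^sub>C v"
      unfolding poly_operator_mult [OF lin] x [symmetric]
      by (simp add: poly_operator_pCons [OF lin] scaleC_minus_left clinear_map_zero [OF lin])
    then show ?thesis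
      using v by blast
  qed
  then show ?case
    unfolding surj_def by metis
qed

section \<open>Von Neumann's inequality for a unitary operator\<close>

lemma unitary_operatorD:
  assumes "unitary_operator U"
  shows unitary_clinear_map: "clinear_map U"
    and unitary_norm: "norm (U x) = norm x"
    and unitary_norm_funpow: "norm ((U ^^ n) x) = norm x"
proof -
  show "clinear_map U"
    using assms by (simp add: unitary_operator_def bounded_operator_def)
  have isometric: "cinner (U x) (U y) = cinner x y" for x y
    using assms by (simp add: unitary_operator_def)
  show norm: "norm (U x) = norm x" for x
    using isometric [of x x] by (simp add: cinner_self flip: of_real_power)
  show "norm ((U ^^ n) x) = norm x"
    by (induction n) (simp_all add: norm)
qed

lemma root_of_unity_power_self: "0 < N \<Longrightarrow> cis (2 * pi * real l / real N) ^ N = 1"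
  unfolding Complex.DeMoivre by (simp add: cis_multiple_2pi)

lemma sum_roots_of_unity:
  assumes "j < N" "k < N"
  defines "w \<equiv> \<lambda>l. cis (2 * pi * real l / real N)"
  shows "(\<Sum>l<N. w l ^ j * cnj (w l ^ k)) = (if j = k then of_nat N else 0)"
proof -
  have N: "real N \<noteq> 0"
    using assms(1) by simp
  define a where "a = w j * cnj (w k)"
  have "w l ^ j * cnj (w l ^ k) = a ^ l" for l
    by (simp add: a_def w_def power_mult_distrib Complex.DeMoivre mult.commute mult.left_commute
        flip: complex_cnj_power)
  then have sum: "(\<Sum>l<N. w l ^ j * cnj (w l ^ k)) = (\<Sum>l<N. a ^ l)"
    by simp
  show ?thesis
  proof (cases "j = k")
    case True
    then have "a = 1"
      by (simp add: a_def w_def cis_cnj cis_mult)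
    then show ?thesis
      using True unfolding sum by simp
  next
    case False
    have "inj_on w {..<N}"
      using Complex.bij_betw_roots_unity [of N] assms(1) by (auto simp: w_def bij_betw_def)
    then have "w j \<noteq> w k"
      using False assms(1,2) by (auto dest: inj_onD)
    moreover have "a * w k = w j"
      by (simp add: a_def w_def cis_cnj cis_mult)
    ultimately have "a \<noteq> 1"
      by auto
    moreover have "a ^ N = 1"
      using assms(1) root_of_unity_power_self [of N]
      by (simp add: a_def w_def power_mult_distrib flip: complex_cnj_power)
    ultimately have "(\<Sum>l<N. a ^ l) = 0"
      using geometric_sum [of a N] by simp
    then show ?thesis
      using False unfolding sum by simp
  qed
qed

lemma finite_Parseval:
  fixes v :: "nat \<Rightarrow> 'a::complex_inner_space"
  defines "w \<equiv> \<lambda>N l. cis (2 * pi * real l / real N)"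
  shows "(\<Sum>l<N. (norm (\<Sum>j<N. (w N l ^ j) *\<^sub>C v j))\<^sup>2) = real N * (\<Sum>j<N. (norm (v j))\<^sup>2)"
proof -
  have "complex_of_real (\<Sum>l<N. (norm (\<Sum>j<N. (w N l ^ j) *\<^sub>C v j))\<^sup>2)
      = (\<Sum>l<N. \<Sum>k<N. \<Sum>j<N. w N l ^ j * cnj (w N l ^ k) * cinner (v j) (v k))"
    by (simp add: cinner_self [symmetric] cinner_sum_left cinner_sum_right cinner_scaleC_left
        cinner_scaleC_right sum_distrib_left mult_ac del: of_real_power)
  also have "\<dots> = (\<Sum>k<N. \<Sum>j<N. \<Sum>l<N. w N l ^ j * cnj (w N l ^ k) * cinner (v j) (v k))"
    by (subst sum.swap) (intro sum.cong refl sum.swap)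
  also have "\<dots> = (\<Sum>k<N. \<Sum>j<N. (if j = k then of_nat N * cinner (v j) (v k) else 0))"
    unfolding sum_distrib_right [symmetric] w_def
    by (intro sum.cong refl, subst sum_roots_of_unity) auto
  also have "\<dots> = complex_of_real (real N * (\<Sum>j<N. (norm (v j))\<^sup>2))"
    by (simp add: cinner_self sum_distrib_left)
  finally show ?thesis
    by (simp only: of_real_eq_iff)
qed

text \<open>
  The constant depends on \<open>p\<close> only, so that it can be used for a whole family of approximate
  eigenvectors \<open>x\<close> and eigenvalues \<open>z\<close> at once.
\<close>

lemma poly_operator_approx_eigenvector:
  fixes U :: "'a::complex_hilbert_space \<Rightarrow> 'a"
  assumes lin: "clinear_map U" and norm: "\<And>x. norm (U x) = norm x"
  shows "\<exists>C. \<forall>x z. cmod z = 1 \<longrightarrow>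
    norm (poly_operator p U x - poly p z *\<^sub>C x) \<le> C * norm (U x - z *\<^sub>C x)"
proof (induction p)
  case (pCons c p)
  then obtain C where C: "\<And>x z. cmod z = 1 \<Longrightarrow>
      norm (poly_operator p U x - poly p z *\<^sub>C x) \<le> C * norm (U x - z *\<^sub>C x)"
    by blast
  have "compact (poly p ` sphere 0 1)"
    by (intro compact_continuous_image continuous_intros) simp
  then obtain M where M: "\<And>z. cmod z = 1 \<Longrightarrow> cmod (poly p z) \<le> M"
    by (force dest!: compact_imp_bounded simp: bounded_iff)
  have "norm (poly_operator (pCons c p) U x - poly (pCons c p) z *\<^sub>C x)
      \<le> (C + M) * norm (U x - z *\<^sub>C x)" if "cmod z = 1" for x z
  proof -
    have "poly_operator (pCons c p) U x - poly (pCons c p) z *\<^sub>C x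
        = U (poly_operator p U x - poly p z *\<^sub>C x) + poly p z *\<^sub>C (U x - z *\<^sub>C x)"
      by (simp add: poly_operator_pCons [OF lin] clinear_map_diff [OF lin]
          clinear_map_scaleC [OF lin] scaleC_diff_right scaleC_scaleC scaleC_add_left mult.commute)
    also have "norm \<dots> \<le> norm (poly_operator p U x - poly p z *\<^sub>C x)
        + cmod (poly p z) * norm (U x - z *\<^sub>C x)"
      by (rule order_trans [OF norm_triangle_ineq]) (simp add: norm)
    also have "\<dots> \<le> C * norm (U x - z *\<^sub>C x) + M * norm (U x - z *\<^sub>C x)"
      by (intro add_mono C M mult_right_mono that) simp
    finally show ?thesis
      by (simp add: distrib_right)
  qed
  then show ?case
    by blast
qed (auto intro: exI [of _ 0])

text \<open>
  For an \<open>N\<close>-th root of unity \<open>w\<close>, the vector \<open>\<Sum>j<N. w\<^sup>j U\<^sup>j e\<close> is an eigenvector of \<open>U\<close> for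
  \<open>cnj w\<close>, up to an error bounded independently of \<open>N\<close>; on it the inequality between
  the polynomials on the circle can be used.  The mean square of \<open>p(U)\<close> on these vectors, over all
  \<open>w\<close>, is \<open>N \<parallel>p(U) e\<parallel>\<^sup>2\<close> by Parseval, so the bounded errors disappear as \<open>N\<close> grows.
\<close>

lemma von_Neumann_unitary:
  fixes U :: "'a::complex_hilbert_space \<Rightarrow> 'a"
  assumes U: "unitary_operator U"
    and le: "\<And>z. cmod z = 1 \<Longrightarrow> cmod (poly p z) \<le> cmod (poly q z)"
  shows "norm (poly_operator p U e) \<le> norm (poly_operator q U e)"
proof -
  note lin = unitary_clinear_map [OF U] and norm = unitary_norm [OF U]
  define w where "w = (\<lambda>N l. cis (2 * pi * real l / real N))"
  define E where "E N l = (\<Sum>j<N. (w N l ^ j) *\<^sub>C (U ^^ j) e)" for N l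
  have poly_E: "poly_operator r U (E N l) = (\<Sum>j<N. (w N l ^ j) *\<^sub>C (U ^^ j) (poly_operator r U e))"
    for r N l
    by (simp add: E_def clinear_map_sum [OF clinear_map_poly_operator [OF lin]]
        clinear_map_scaleC [OF clinear_map_poly_operator [OF lin]] poly_operator_funpow [OF lin])
  have mean: "L2_set (\<lambda>l. norm (poly_operator r U (E N l))) {..<N}
      = real N * norm (poly_operator r U e)" for r N
  proof -
    have "(\<Sum>l<N. (norm (poly_operator r U (E N l)))\<^sup>2) = (real N * norm (poly_operator r U e))\<^sup>2"
      unfolding poly_E w_def finite_Parseval
      by (simp add: unitary_norm_funpow [OF U] power2_eq_square)
    then show ?thesis
      by (simp add: L2_set_def)
  qed
  have eigen: "norm (U (E N l) - cnj (w N l) *\<^sub>C E N l) \<le> 2 * norm e" if "l < N" for N l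
  proof -
    let ?w = "w N l"
    have ww: "?w * cnj ?w = 1"
      by (simp add: w_def cis_cnj cis_mult)
    have wN: "?w ^ N = 1"
      using that by (simp add: w_def root_of_unity_power_self)
    have "?w *\<^sub>C (U (E N l) - cnj ?w *\<^sub>C E N l) = ?w *\<^sub>C U (E N l) - E N l"
      by (simp add: scaleC_diff_right scaleC_scaleC ww)
    also have "\<dots> = (\<Sum>j<N. (?w ^ Suc j) *\<^sub>C (U ^^ Suc j) e - (?w ^ j) *\<^sub>C (U ^^ j) e)"
      by (simp add: E_def clinear_map_sum [OF lin] clinear_map_scaleC [OF lin] scaleC_sum_right
          scaleC_scaleC sum_subtractf)
    also have "\<dots> = (U ^^ N) e - e"
      using sum_lessThan_telescope [of "\<lambda>j. (?w ^ j) *\<^sub>C (U ^^ j) e" N] by (simp add: wN)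
    finally have "norm (?w *\<^sub>C (U (E N l) - cnj ?w *\<^sub>C E N l)) \<le> norm ((U ^^ N) e) + norm e"
      by (simp only: norm_triangle_ineq4)
    then show ?thesis
      by (simp add: unitary_norm_funpow [OF U]) (simp add: w_def)
  qed
  obtain C D where
    C: "\<And>x z. cmod z = 1 \<Longrightarrow> norm (poly_operator p U x - poly p z *\<^sub>C x) \<le> C * norm (U x - z *\<^sub>C x)"
    and D: "\<And>x z. cmod z = 1 \<Longrightarrow> norm (poly_operator q U x - poly q z *\<^sub>C x) \<le> D * norm (U x - z *\<^sub>C x)"
    using poly_operator_approx_eigenvector [OF lin norm] by metis
  define K where "K = (\<bar>C\<bar> + \<bar>D\<bar>) * (2 * norm e)"
  have K: "0 \<le> K"
    by (simp add: K_def)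
  have pointwise: "norm (poly_operator p U (E N l)) \<le> norm (poly_operator q U (E N l)) + K"
    if "l < N" for N l
  proof -
    let ?z = "cnj (w N l)" and ?x = "E N l"
    have z: "cmod ?z = 1"
      by (simp add: w_def)
    have "norm (poly_operator p U ?x - poly p ?z *\<^sub>C ?x) \<le> \<bar>C\<bar> * (2 * norm e)"
      by (rule order_trans [OF C [OF z]]) (intro mult_mono eigen that; simp)
    moreover have "norm (poly_operator q U ?x - poly q ?z *\<^sub>C ?x) \<le> \<bar>D\<bar> * (2 * norm e)"
      by (rule order_trans [OF D [OF z]]) (intro mult_mono eigen that; simp)
    moreover have "norm (poly p ?z *\<^sub>C ?x) \<le> norm (poly q ?z *\<^sub>C ?x)"
      unfolding norm_scaleC by (intro mult_right_mono le z) simp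
    moreover have "norm (poly_operator p U ?x)
        \<le> norm (poly p ?z *\<^sub>C ?x) + norm (poly_operator p U ?x - poly p ?z *\<^sub>C ?x)"
      by (rule norm_triangle_sub)
    moreover have "norm (poly q ?z *\<^sub>C ?x)
        \<le> norm (poly_operator q U ?x) + norm (poly_operator q U ?x - poly q ?z *\<^sub>C ?x)"
      by (metis norm_minus_commute norm_triangle_sub)
    ultimately show ?thesis
      by (simp add: K_def distrib_right)
  qed
  show ?thesis
  proof (rule ccontr)
    assume "\<not> ?thesis"
    then have gap: "0 < norm (poly_operator p U e) - norm (poly_operator q U e)" (is "0 < ?g")
      by simp
    obtain N where N: "(K / ?g)\<^sup>2 < real N"
      using reals_Archimedean2 by blast
    then have N0: "0 < real N"
      using zero_le_power2 [of "K / ?g"] by linarith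
    have "real N * norm (poly_operator p U e)
        \<le> L2_set (\<lambda>l. norm (poly_operator q U (E N l)) + K) {..<N}"
      unfolding mean [symmetric] by (intro L2_set_mono pointwise) auto
    also have "\<dots> \<le> L2_set (\<lambda>l. norm (poly_operator q U (E N l))) {..<N} + L2_set (\<lambda>l. K) {..<N}"
      by (rule L2_set_triangle_ineq)
    also have "\<dots> = real N * norm (poly_operator q U e) + sqrt (real N) * K"
      using K unfolding mean by (simp add: L2_set_def real_sqrt_mult)
    finally have "real N * ?g \<le> sqrt (real N) * K"
      by (simp add: algebra_simps)
    then have "sqrt (real N) * (sqrt (real N) * ?g) \<le> sqrt (real N) * K"
      by (simp flip: mult.assoc)
    then have "sqrt (real N) * ?g \<le> K"
      using N0 by simp
    moreover have "K / ?g < sqrt (real N)"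
      using N by (rule real_less_rsqrt)
    ultimately show False
      using gap by (simp add: divide_less_eq)
  qed
qed

section \<open>The inequality between Gram matrices\<close>

lemma k_rho_quadratic: "(k_rho \<rho> s)\<^sup>2 = \<rho> * (1 - s\<^sup>2) * k_rho \<rho> s + s\<^sup>2"
proof -
  define h where "h = \<rho> / 2 * (1 - s\<^sup>2)"
  have k: "k_rho \<rho> s = h + sqrt (h\<^sup>2 + s\<^sup>2)"
    by (simp add: k_rho_def h_def power_mult_distrib power_divide)
  have "(sqrt (h\<^sup>2 + s\<^sup>2))\<^sup>2 = h\<^sup>2 + s\<^sup>2"
    by simp
  then have "(k_rho \<rho> s)\<^sup>2 = 2 * h * k_rho \<rho> s + s\<^sup>2"
    unfolding k by algebra
  then show ?thesis
    by (simp add: h_def)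
qed

text \<open>
  The letters stand for a Gram matrix: \<open>X\<close>, \<open>Y\<close>, \<open>r\<close> for the squared norms and inner product of
  \<open>x\<^sub>L\<close> and \<open>y\<^sub>L\<close>; \<open>P\<close>, \<open>S\<close>, \<open>R\<close> for those of \<open>x\<^sub>N\<close> and \<open>y\<^sub>N\<close>; \<open>\<mu>\<close>, \<open>mx\<close>, \<open>my\<close> for
  \<open>\<parallel>m\<parallel>\<^sup>2\<close>, \<open>\<langle>m, x\<^sub>N\<rangle>\<close>, \<open>\<langle>m, y\<^sub>N\<rangle>\<close>.  With \<open>D\<close>, \<open>E\<close>, \<open>a\<close>, \<open>b\<close>, \<open>a'\<close>, \<open>b'\<close> as in the proof, the inequality follows
  from the identity
  \<open>k\<^sup>2 \<parallel>x + s y\<parallel>\<^sup>2 - \<parallel>y + s x\<parallel>\<^sup>2 = D (k / \<rho> (\<rho>\<^sup>2 \<parallel>x\<^sub>L\<parallel>\<^sup>2 - \<rho>\<^sup>2 \<parallel>y\<^sub>L\<parallel>\<^sup>2 - \<parallel>m\<parallel>\<^sup>2)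
    + k / \<rho> \<parallel>m - \<rho> (a x\<^sub>N + b y\<^sub>N)\<parallel>\<^sup>2 + (k - 1)\<^sup>2 \<parallel>y\<^sub>L\<parallel>\<^sup>2 + \<parallel>a' x\<^sub>N + b' y\<^sub>N\<parallel>\<^sup>2)\<close>.
  Both sides are linear in the entries of the Gram matrix, so the identity is checked for the
  coefficient of each entry.
\<close>

lemma gram_inequality:
  fixes k s \<rho> :: real
  assumes k: "1 \<le> k" and s: "0 \<le> s" "s < 1"
    and k_eq: "k\<^sup>2 = \<rho> * (1 - s\<^sup>2) * k + s\<^sup>2" and \<rho>: "1 \<le> \<rho>"
    and X: "\<mu> + \<rho>\<^sup>2 * Y \<le> \<rho>\<^sup>2 * X" and Y: "0 \<le> Y"
    and mx: "mx = R - (\<rho> - 1) * r" and my: "my = S - (\<rho> - 1) * Y"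
    and square_m: "\<And>a b. 0 \<le> \<mu> + a\<^sup>2 * P + b\<^sup>2 * S + 2 * a * b * R - 2 * a * mx - 2 * b * my"
    and square: "\<And>a b. 0 \<le> a\<^sup>2 * P + b\<^sup>2 * S + 2 * a * b * R"
  shows "(Y + S) + 2 * s * (r + R) + s\<^sup>2 * (X + P) \<le> k\<^sup>2 * ((X + P) + 2 * s * (r + R) + s\<^sup>2 * (Y + S))"
proof -
  define D where "D = 1 - s\<^sup>2"
  define E where "E = k + s\<^sup>2"
  define a where "a = s * (1 + k) / E"
  define b where "b = (1 + s\<^sup>2 * k) / E"
  define a' where "a' = (k\<^sup>2 - s\<^sup>2) / E"
  define b' where "b' = s * (k\<^sup>2 - 1) / E"
  have D: "0 < D"
    using s by (simp add: D_def power_less_one_iff)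
  have E: "0 < E"
    using k by (simp add: E_def add_pos_nonneg)
  have E2: "E\<^sup>2 = s\<^sup>2 * (k + 1)\<^sup>2 + D * (k\<^sup>2 - s\<^sup>2)"
    by (simp add: E_def D_def) algebra
  have \<rho>k: "D * (\<rho> * k) = k\<^sup>2 - s\<^sup>2"
    using k_eq by (simp add: D_def algebra_simps)
  have "k * (D * (\<rho> - 1)) = (k - 1) * E"
    using \<rho>k by (simp add: D_def E_def algebra_simps power2_eq_square)
  then have \<rho>1: "D * ((\<rho> - 1) * k) / E = k - 1"
    using E by (simp add: field_simps)
  \<comment> \<open>The coefficients of \<open>r\<close>, \<open>Y\<close>, \<open>P\<close>, \<open>R\<close> and \<open>S\<close>; that of \<open>X\<close> is \<open>D \<rho> k\<close>.\<close>
  have cr: "2 * (D * ((\<rho> - 1) * k) * a) = 2 * s * (k\<^sup>2 - 1)"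
  proof -
    have "D * ((\<rho> - 1) * k) * a = (D * ((\<rho> - 1) * k) / E) * (s * (1 + k))"
      by (simp add: a_def)
    then show ?thesis
      unfolding \<rho>1 by (simp add: algebra_simps power2_eq_square)
  qed
  have cY: "- (D * (\<rho> * k)) + 2 * (D * ((\<rho> - 1) * k) * b) + D * (k - 1)\<^sup>2 = k\<^sup>2 * s\<^sup>2 - 1"
  proof -
    have "D * ((\<rho> - 1) * k) * b = (D * ((\<rho> - 1) * k) / E) * (1 + s\<^sup>2 * k)"
      by (simp add: b_def)
    then have Db: "D * ((\<rho> - 1) * k) * b = (k - 1) * (1 + s\<^sup>2 * k)"
      unfolding \<rho>1 .
    show ?thesis
      unfolding Db \<rho>k unfolding D_def by algebra
  qed
  have cP: "D * (\<rho> * k) * a\<^sup>2 + D * a'\<^sup>2 = k\<^sup>2 - s\<^sup>2"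
  proof -
    have "(k\<^sup>2 - s\<^sup>2) * (s * (1 + k))\<^sup>2 + D * (k\<^sup>2 - s\<^sup>2)\<^sup>2 = (k\<^sup>2 - s\<^sup>2) * E\<^sup>2"
      unfolding E2 by algebra
    then show ?thesis
      unfolding \<rho>k a_def a'_def using E by (simp add: field_simps)
  qed
  have cR: "D * (\<rho> * k) * a * b - D * k * a + D * a' * b' = s * (k\<^sup>2 - 1)"
  proof -
    have "(k\<^sup>2 - s\<^sup>2) * (s * (1 + k)) * (1 + s\<^sup>2 * k) - D * k * (s * (1 + k)) * E
        + D * (k\<^sup>2 - s\<^sup>2) * (s * (k\<^sup>2 - 1)) = s * (k\<^sup>2 - 1) * E\<^sup>2"
      by (simp add: D_def E_def) algebra
    then show ?thesis
      unfolding \<rho>k a_def b_def a'_def b'_def using E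
      by (simp add: divide_simps power2_eq_square)
  qed
  have cS: "D * (\<rho> * k) * b\<^sup>2 - 2 * (D * k * b) + D * b'\<^sup>2 = k\<^sup>2 * s\<^sup>2 - 1"
  proof -
    have "(k\<^sup>2 - s\<^sup>2) * (1 + s\<^sup>2 * k)\<^sup>2 - 2 * (D * k * (1 + s\<^sup>2 * k)) * E
        + D * (s * (k\<^sup>2 - 1))\<^sup>2 = (k\<^sup>2 * s\<^sup>2 - 1) * E\<^sup>2"
      by (simp add: D_def E_def) algebra
    then show ?thesis
      unfolding \<rho>k b_def b'_def using E by (simp add: divide_simps power2_eq_square)
  qed
  have "0 \<le> D * (k / \<rho> * (\<rho>\<^sup>2 * X - \<rho>\<^sup>2 * Y - \<mu>)
      + k / \<rho> * (\<mu> + (\<rho> * a)\<^sup>2 * P + (\<rho> * b)\<^sup>2 * S + 2 * (\<rho> * a) * (\<rho> * b) * R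
          - 2 * (\<rho> * a) * mx - 2 * (\<rho> * b) * my)
      + (k - 1)\<^sup>2 * Y + (a'\<^sup>2 * P + b'\<^sup>2 * S + 2 * a' * b' * R))"
    using D k \<rho> X Y
    by (intro mult_nonneg_nonneg add_nonneg_nonneg square_m square) auto
  also have "\<dots> = D * (\<rho> * k * (X - Y)
      + k * (\<rho> * a\<^sup>2 * P + \<rho> * b\<^sup>2 * S + 2 * \<rho> * a * b * R - 2 * a * mx - 2 * b * my)
      + (k - 1)\<^sup>2 * Y + (a'\<^sup>2 * P + b'\<^sup>2 * S + 2 * a' * b' * R))"
    using \<rho> by (simp add: field_simps power2_eq_square)
  also have "\<dots> = (D * (\<rho> * k)) * X + (2 * (D * ((\<rho> - 1) * k) * a)) * r
      + (- (D * (\<rho> * k)) + 2 * (D * ((\<rho> - 1) * k) * b) + D * (k - 1)\<^sup>2) * Y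
      + (D * (\<rho> * k) * a\<^sup>2 + D * a'\<^sup>2) * P
      + 2 * (D * (\<rho> * k) * a * b - D * k * a + D * a' * b') * R
      + (D * (\<rho> * k) * b\<^sup>2 - 2 * (D * k * b) + D * b'\<^sup>2) * S"
    unfolding mx my by (simp add: algebra_simps)
  also have "\<dots> = (k\<^sup>2 - s\<^sup>2) * X + 2 * s * (k\<^sup>2 - 1) * r + (k\<^sup>2 * s\<^sup>2 - 1) * Y
      + (k\<^sup>2 - s\<^sup>2) * P + 2 * (s * (k\<^sup>2 - 1)) * R + (k\<^sup>2 * s\<^sup>2 - 1) * S"
    unfolding cr cY cP cR cS unfolding \<rho>k ..
  finally show ?thesis
    by (simp add: algebra_simps)
qed

section \<open>Operators with a unitary dilation\<close>

text \<open>
  The projection in the definition of a unitary \<open>\<rho>\<close>-dilation is replaced by inner products with the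
  vectors \<open>J v\<close>.  All later arguments use scalar moments of this form.
\<close>

locale rho_dilation =
  fixes \<rho> :: real
    and A :: "'a::complex_hilbert_space \<Rightarrow> 'a"
    and J :: "'a \<Rightarrow> 'k::complex_hilbert_space"
    and U :: "'k \<Rightarrow> 'k"
  assumes \<rho>_ge_1: "1 \<le> \<rho>"
    and A: "bounded_operator A"
    and J: "isometric_embedding J"
    and U: "unitary_operator U"
    and cinner_funpow: "1 \<le> n \<Longrightarrow> cinner ((A ^^ n) x) v = \<rho> * cinner ((U ^^ n) (J x)) (J v)"
begin

lemma clinear_A: "clinear_map A"
  using A by (simp add: bounded_operator_def)

lemma clinear_J: "clinear_map J"
  using J by (simp add: isometric_embedding_def)

lemma cinner_J: "cinner (J x) (J y) = cinner x y"
  using J by (simp add: isometric_embedding_def)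

lemmas norm_J = isometric_embedding_norm [OF J]

lemmas clinear_U = unitary_clinear_map [OF U]

lemma norm_funpow_le: "norm ((A ^^ n) x) \<le> \<rho> * norm x"
proof (cases "n = 0")
  case True
  then show ?thesis
    using mult_right_mono [OF \<rho>_ge_1, of "norm x"] by simp
next
  case False
  let ?y = "(A ^^ n) x"
  have "norm ?y * norm ?y = cmod (cinner ?y ?y)"
    by (simp add: cinner_self power2_eq_square norm_mult)
  also have "\<dots> = \<rho> * cmod (cinner ((U ^^ n) (J x)) (J ?y))"
    using False \<rho>_ge_1 by (subst cinner_funpow) (simp_all add: norm_mult)
  also have "\<dots> \<le> \<rho> * (norm ((U ^^ n) (J x)) * norm (J ?y))"
    using \<rho>_ge_1 by (intro mult_left_mono Cauchy_Schwarz_cinner) auto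
  finally have "norm ?y * norm ?y \<le> (\<rho> * norm x) * norm ?y"
    by (simp add: unitary_norm_funpow [OF U] norm_J mult.assoc)
  then show ?thesis
    using \<rho>_ge_1 by (cases "?y = 0") (auto intro: mult_right_le_imp_le)
qed

text \<open>
  The dilation identity says nothing about the power \<open>0\<close>, hence the condition on \<open>p(0)\<close>.
\<close>

lemma cinner_poly_operator_dilation:
  assumes "poly p 0 = 0"
  shows "cinner (poly_operator p A x) v = \<rho> * cinner (poly_operator p U (J x)) (J v)"
proof -
  have "cinner (coeff p i *\<^sub>C (A ^^ i) x) v = \<rho> * cinner (coeff p i *\<^sub>C (U ^^ i) (J x)) (J v)" for i
    using assms cinner_funpow [of i x v]
    by (cases "i = 0") (simp_all add: cinner_scaleC_left poly_0_coeff_0)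
  then show ?thesis
    by (simp add: poly_operator_def cinner_sum_left sum_distrib_left)
qed

lemma poly_operator_A_surj:
  "\<forall>z\<in>cball 0 1. poly q z \<noteq> 0 \<Longrightarrow> surj (poly_operator q A)"
  using power_bounded_poly_operator_surj [OF A norm_funpow_le] .

lemma poly_operator_U_surj:
  assumes "\<forall>z\<in>cball 0 1. poly q z \<noteq> 0"
  shows "surj (poly_operator q U)"
proof (rule power_bounded_poly_operator_surj [OF _ _ assms])
  show "bounded_operator U"
    using U by (simp add: unitary_operator_def)
  show "norm ((U ^^ n) x) \<le> 1 * norm x" for n x
    by (simp add: unitary_norm_funpow [OF U])
qed

lemma bounded_moments:
  "\<exists>C. \<forall>j. cmod (cinner ((U ^^ j) e) (J v)) \<le> C"
  using Cauchy_Schwarz_cinner [of _ "J v"] by (metis unitary_norm_funpow [OF U])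

text \<open>
  With \<open>x = d(A) z\<close> this is the identity
  \<open>\<langle>(p g)(A) x, v\<rangle> = \<rho> \<langle>(p g)(U) J x, J v\<rangle>\<close> for the rational function \<open>g = n / d\<close>.  The vector
  \<open>e = d(U)\<^bsup>-1\<^esup> J x\<close> need not be \<open>J z\<close>, but the difference of the two sides, as a functional of
  \<open>p\<close>, vanishes on multiples of \<open>d\<close>, where the polynomial case applies, and has bounded moments.
\<close>

lemma dilation_rational:
  assumes d: "\<forall>z\<in>cball 0 1. poly d z \<noteq> 0" and n: "poly n 0 = 0"
    and e: "poly_operator d U e = J (poly_operator d A z)"
  shows "cinner (poly_operator (p * n) A z) v = \<rho> * cinner (poly_operator (p * n) U e) (J v)"
proof -
  define \<phi> where "\<phi> p = \<rho> * cinner (poly_operator (p * n) U e) (J v)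
      - cinner (poly_operator (p * n) A z) v" for p
  have "\<phi> p = 0"
  proof (rule bounded_functional_vanishing_on_ideal [OF d])
    show "\<phi> (p + q) = \<phi> p + \<phi> q" for p q
      by (simp add: \<phi>_def distrib_right poly_operator_add cinner_add_left algebra_simps)
    show "\<phi> (smult c p) = c * \<phi> p" for c p
      by (simp add: \<phi>_def poly_operator_smult cinner_scaleC_left algebra_simps)
    show "\<exists>C. \<forall>j. cmod (\<phi> (monom 1 j * p)) \<le> C" for p
    proof (intro exI allI)
      fix j
      let ?u = "poly_operator (p * n) U e" and ?a = "poly_operator (p * n) A z"
      have "\<phi> (monom 1 j * p) = \<rho> * cinner ((U ^^ j) ?u) (J v) - cinner ((A ^^ j) ?a) v"
        by (simp add: \<phi>_def mult.assoc poly_operator_monom_mult [OF clinear_U]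
            poly_operator_monom_mult [OF clinear_A])
      also have "cmod \<dots> \<le> cmod (\<rho> * cinner ((U ^^ j) ?u) (J v)) + cmod (cinner ((A ^^ j) ?a) v)"
        by (rule norm_triangle_ineq4)
      also have "\<dots> \<le> \<rho> * (norm ((U ^^ j) ?u) * norm (J v)) + norm ((A ^^ j) ?a) * norm v"
        unfolding norm_mult using \<rho>_ge_1
        by (intro add_mono mult_mono Cauchy_Schwarz_cinner) auto
      also have "\<dots> \<le> \<rho> * (norm ?u * norm (J v)) + \<rho> * norm ?a * norm v"
        unfolding unitary_norm_funpow [OF U]
        by (intro add_left_mono mult_right_mono norm_funpow_le) simp
      finally show "cmod (\<phi> (monom 1 j * p)) \<le> \<rho> * (norm ?u * norm (J v)) + \<rho> * norm ?a * norm v" .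
    qed
    show "\<phi> (d * p) = 0" for p
    proof -
      have swap: "d * p * n = (p * n) * d"
        by (simp add: mult_ac)
      show ?thesis
        unfolding \<phi>_def swap poly_operator_mult [OF clinear_U, of "p * n" d]
          poly_operator_mult [OF clinear_A, of "p * n" d] e
        using n by (simp add: cinner_poly_operator_dilation)
    qed
  qed
  then show ?thesis
    by (simp add: \<phi>_def)
qed

text \<open>
  Since \<open>U\<close> is unitary, this is the orthogonal complement of the vectors \<open>U\<^bsup>-j\<^esup> J v\<close> with \<open>j \<ge> 1\<close>.
\<close>

definition past_complement :: "'k set" where
  "past_complement = {e. \<forall>j\<ge>1. \<forall>v. cinner ((U ^^ j) e) (J v) = 0}"

lemma past_complement_projection:
  "\<exists>z\<in>past_complement. \<forall>m\<in>past_complement. cinner (y - z) m = 0"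
proof (rule orthogonal_projection_exists)
  note lin = clinear_map_funpow [OF clinear_U]
  show "0 \<in> past_complement"
    by (simp add: past_complement_def clinear_map_zero [OF lin])
  show "x + y \<in> past_complement" if "x \<in> past_complement" "y \<in> past_complement" for x y
    using that by (simp add: past_complement_def clinear_map_add [OF lin] cinner_add_left)
  show "c *\<^sub>C x \<in> past_complement" if "x \<in> past_complement" for c x
    using that by (simp add: past_complement_def clinear_map_scaleC [OF lin] cinner_scaleC_left)
  have "bounded_linear U"
    using U by (simp add: unitary_operator_def bounded_operator_def)
  then have "continuous_on UNIV (U ^^ j)" for j
    by (induction j) (auto simp: o_def id_def intro: bounded_linear.continuous_on)
  then have "continuous_on UNIV (\<lambda>e. cinner ((U ^^ j) e) (J v))" for j v
    using continuous_on_compose2 [OF linear_continuous_on [OF bounded_linear_cinner_left]] by blast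
  then have "closed {e. cinner ((U ^^ j) e) (J v) = 0}" for j v
    by (intro closed_Collect_eq continuous_on_const)
  then show "closed past_complement"
    unfolding past_complement_def by (intro closed_Collect_all closed_Collect_imp) auto
qed

lemma cinner_poly_operator_past_complement:
  assumes "x \<in> past_complement" "poly p 0 = 0"
  shows "cinner (poly_operator p U x) (J v) = 0"
proof -
  have "coeff p i * cinner ((U ^^ i) x) (J v) = 0" for i
    using assms by (cases "i = 0") (auto simp: past_complement_def poly_0_coeff_0)
  then show ?thesis
    unfolding poly_operator_def cinner_sum_left cinner_scaleC_left by (intro sum.neutral ballI)
qed

text \<open>
  For \<open>g = n / d\<close> and a vector of the complement, \<open>(p g)(U)\<close> formally involves only the powers
  \<open>U\<^sup>j\<close> with \<open>j \<ge> 1\<close>.  The denominator is removed as in \<open>dilation_rational\<close>.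
\<close>

lemma past_complement_rational:
  assumes d: "\<forall>z\<in>cball 0 1. poly d z \<noteq> 0" and n: "poly n 0 = 0"
    and e: "poly_operator d U e \<in> past_complement"
  shows "cinner (poly_operator (p * n) U e) (J v) = 0"
proof (rule bounded_functional_vanishing_on_ideal
      [OF d, where \<phi> = "\<lambda>p. cinner (poly_operator (p * n) U e) (J v)"])
  show "cinner (poly_operator ((p + q) * n) U e) (J v)
      = cinner (poly_operator (p * n) U e) (J v) + cinner (poly_operator (q * n) U e) (J v)" for p q
    by (simp add: distrib_right poly_operator_add cinner_add_left)
  show "cinner (poly_operator (smult c p * n) U e) (J v) = c * cinner (poly_operator (p * n) U e) (J v)"
    for c p
    by (simp add: poly_operator_smult cinner_scaleC_left)
  show "\<exists>C. \<forall>j. cmod (cinner (poly_operator (monom 1 j * p * n) U e) (J v)) \<le> C" for p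
    unfolding mult.assoc poly_operator_monom_mult [OF clinear_U] by (rule bounded_moments)
  show "cinner (poly_operator (d * p * n) U e) (J v) = 0" for p
  proof -
    have swap: "d * p * n = (p * n) * d"
      by (simp add: mult_ac)
    show ?thesis
      unfolding swap poly_operator_mult [OF clinear_U, of "p * n" d]
      using e n by (intro cinner_poly_operator_past_complement) auto
  qed
qed

text \<open>
  With \<open>y = g(A) x\<close> for \<open>g = n / d\<close>, this bounds the Moebius transform \<open>(g + s) / (1 + s g)\<close> of \<open>g\<close> at
  \<open>A\<close>.  The vectors \<open>a\<close> and \<open>b\<close> of the proof make \<open>\<zeta> = \<rho> g(U) x\<^sub>L\<close> meaningful
  without inverting \<open>d(U)\<close>.
\<close>

lemma moebius_norm_le:
  fixes k s :: real and z :: 'a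
  assumes d: "\<forall>z\<in>cball 0 1. poly d z \<noteq> 0" and n: "poly n 0 = 0"
    and le: "\<And>z. cmod z = 1 \<Longrightarrow> cmod (poly n z) \<le> cmod (poly d z)"
    and k: "1 \<le> k" and s: "0 \<le> s" "s < 1" and k_eq: "k\<^sup>2 = \<rho> * (1 - s\<^sup>2) * k + s\<^sup>2"
  defines "x \<equiv> poly_operator d A z" and "y \<equiv> poly_operator n A z"
  shows "norm (y + s *\<^sub>R x) \<le> k * norm (x + s *\<^sub>R y)"
proof -
  let ?N = past_complement
  note lin = clinear_map_funpow [OF clinear_U]
  obtain xN where xN: "xN \<in> ?N" and xN_orth: "\<forall>m\<in>?N. cinner (J x - xN) m = 0"
    using past_complement_projection by blast
  obtain yN where yN: "yN \<in> ?N" and yN_orth: "\<forall>m\<in>?N. cinner (J y - yN) m = 0"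
    using past_complement_projection by blast
  define xL where "xL = J x - xN"
  define yL where "yL = J y - yN"
  have Jx: "J x = xL + xN" and Jy: "J y = yL + yN"
    by (simp_all add: xL_def yL_def)
  obtain a b where a: "poly_operator d U a = J x" and b: "poly_operator d U b = xN"
    using poly_operator_U_surj [OF d] by (metis surjD)
  define \<zeta> where "\<zeta> = \<rho> *\<^sub>R poly_operator n U (a - b)"
  \<comment> \<open>In place of \<open>x\<^sub>L\<close> one may compute with \<open>J x\<close>: the part \<open>x\<^sub>N\<close> contributes nothing.\<close>
  have \<zeta>_moments: "cinner ((U ^^ j) \<zeta>) (J v) = cinner ((A ^^ j) y) v" for j v
  proof -
    have "cinner ((U ^^ j) \<zeta>) (J v)
        = \<rho> * cinner (poly_operator (monom 1 j * n) U a) (J v)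
          - \<rho> * cinner (poly_operator (monom 1 j * n) U b) (J v)"
      by (simp add: \<zeta>_def scaleR_eq_scaleC clinear_map_scaleC [OF lin] cinner_scaleC_left
          clinear_map_diff [OF clinear_map_poly_operator [OF clinear_U]] clinear_map_diff [OF lin]
          cinner_diff_left poly_operator_monom_mult [OF clinear_U] right_diff_distrib)
    also have "\<dots> = cinner (poly_operator (monom 1 j * n) A z) v"
      using dilation_rational [OF d n, of a z "monom 1 j" v] a
        past_complement_rational [OF d n, of b "monom 1 j" v] b xN
      by (simp add: x_def)
    finally show ?thesis
      by (simp add: y_def poly_operator_monom_mult [OF clinear_A])
  qed
  define m where "m = \<zeta> - \<rho> *\<^sub>R yL"
  have m: "m \<in> ?N"
    unfolding past_complement_def
  proof (intro CollectI allI impI)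
    fix j :: nat and v
    assume j: "1 \<le> j"
    have "cinner ((U ^^ j) yN) (J v) = 0"
      using yN j by (simp add: past_complement_def)
    then have "\<rho> * cinner ((U ^^ j) yL) (J v) = cinner ((A ^^ j) y) v"
      using cinner_funpow [OF j, of y v] by (simp add: Jy clinear_map_add [OF lin] cinner_add_left)
    then show "cinner ((U ^^ j) m) (J v) = 0"
      by (simp add: m_def scaleR_eq_scaleC clinear_map_diff [OF lin] clinear_map_scaleC [OF lin]
          cinner_diff_left cinner_scaleC_left \<zeta>_moments)
  qed
  have \<zeta>: "\<zeta> = m + \<rho> *\<^sub>R yL"
    by (simp add: m_def)
  have orth: "cinner xL xN = 0" "cinner xL yN = 0" "cinner xL m = 0"
      "cinner yL xN = 0" "cinner yL yN = 0" "cinner yL m = 0"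
    using xN_orth yN_orth xN yN m by (auto simp: xL_def yL_def)
  have orth': "cinner xN xL = 0" "cinner yN xL = 0" "cinner m xL = 0"
      "cinner xN yL = 0" "cinner yN yL = 0" "cinner m yL = 0"
    using orth by (auto simp: cinner_eq_zero_commute)
  have "norm \<zeta> \<le> \<rho> * norm (poly_operator d U (a - b))"
    using von_Neumann_unitary [OF U le, of "a - b"] \<rho>_ge_1 by (simp add: \<zeta>_def)
  also have "poly_operator d U (a - b) = xL"
    by (simp add: clinear_map_diff [OF clinear_map_poly_operator [OF clinear_U]] a b xL_def)
  finally have "(norm \<zeta>)\<^sup>2 \<le> (\<rho> * norm xL)\<^sup>2"
    by (intro power_mono) auto
  then have norm_m: "(norm m)\<^sup>2 + \<rho>\<^sup>2 * (norm yL)\<^sup>2 \<le> \<rho>\<^sup>2 * (norm xL)\<^sup>2"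
    by (simp add: \<zeta> norm_add_square cinner_scaleR_right orth' power_mult_distrib)
  \<comment> \<open>The case \<open>v = x\<close> and the case \<open>v = y\<close> give the two linear relations.\<close>
  have moment0: "cinner \<zeta> (J v) = cinner (J y) (J v)" for v
    using \<zeta>_moments [of 0 v] by (simp add: cinner_J)
  let ?ip = "\<lambda>u v. Re (cinner u v)"
  have "?ip m xN + \<rho> * ?ip yL xL = ?ip yL xL + ?ip yN xN"
    using arg_cong [OF moment0 [of x], of Re] unfolding Jx Jy \<zeta>
    by (simp add: cinner_add_left cinner_add_right cinner_scaleR_left orth orth')
  then have mx: "?ip m xN = ?ip yN xN - (\<rho> - 1) * ?ip yL xL"
    by (simp add: algebra_simps)
  have "?ip m yN + \<rho> * ?ip yL yL = ?ip yL yL + ?ip yN yN"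
    using arg_cong [OF moment0 [of y], of Re] unfolding Jy \<zeta>
    by (simp add: cinner_add_left cinner_add_right cinner_scaleR_left orth orth')
  then have my: "?ip m yN = (norm yN)\<^sup>2 - (\<rho> - 1) * (norm yL)\<^sup>2"
    by (simp add: norm_square_eq_cinner algebra_simps)
  have norm_J_combination: "(norm (u *\<^sub>R x + t *\<^sub>R y))\<^sup>2
      = u\<^sup>2 * ((norm xL)\<^sup>2 + (norm xN)\<^sup>2) + 2 * u * t * (?ip yL xL + ?ip yN xN)
        + t\<^sup>2 * ((norm yL)\<^sup>2 + (norm yN)\<^sup>2)" for u t
  proof -
    have eq: "norm (u *\<^sub>R x + t *\<^sub>R y) = norm (u *\<^sub>R J x + t *\<^sub>R J y)"
      by (metis norm_J clinear_map_add [OF clinear_J] clinear_map_scaleC [OF clinear_J]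
          scaleR_eq_scaleC)
    show ?thesis
      unfolding eq Jx Jy norm_square_eq_cinner
      by (simp add: cinner_add_left cinner_add_right cinner_scaleR_left
          cinner_scaleR_right orth orth' Re_cinner_commute [of xL yL] Re_cinner_commute [of xN yN]
          power2_eq_square algebra_simps)
  qed
  have square_m: "0 \<le> (norm m)\<^sup>2 + u\<^sup>2 * (norm xN)\<^sup>2 + t\<^sup>2 * (norm yN)\<^sup>2
      + 2 * u * t * ?ip yN xN - 2 * u * ?ip m xN - 2 * t * ?ip m yN" for u t
  proof -
    have "(norm (m - (u *\<^sub>R xN + t *\<^sub>R yN)))\<^sup>2
        = (norm m)\<^sup>2 + u\<^sup>2 * (norm xN)\<^sup>2 + t\<^sup>2 * (norm yN)\<^sup>2
          + 2 * u * t * ?ip yN xN - 2 * u * ?ip m xN - 2 * t * ?ip m yN"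
      unfolding norm_square_eq_cinner
      by (simp add: cinner_add_left cinner_add_right cinner_diff_left cinner_diff_right
          cinner_scaleR_left cinner_scaleR_right Re_cinner_commute [of xN yN]
          Re_cinner_commute [of xN m] Re_cinner_commute [of yN m] power2_eq_square algebra_simps)
    then show ?thesis
      by (metis zero_le_power2)
  qed
  have square: "0 \<le> u\<^sup>2 * (norm xN)\<^sup>2 + t\<^sup>2 * (norm yN)\<^sup>2 + 2 * u * t * ?ip yN xN" for u t
  proof -
    have "(norm (u *\<^sub>R xN + t *\<^sub>R yN))\<^sup>2
        = u\<^sup>2 * (norm xN)\<^sup>2 + t\<^sup>2 * (norm yN)\<^sup>2 + 2 * u * t * ?ip yN xN"
      unfolding norm_square_eq_cinner
      by (simp add: cinner_add_left cinner_add_right cinner_scaleR_left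
          cinner_scaleR_right Re_cinner_commute [of xN yN] power2_eq_square algebra_simps)
    then show ?thesis
      by (metis zero_le_power2)
  qed
  have "(norm (y + s *\<^sub>R x))\<^sup>2 \<le> (k * norm (x + s *\<^sub>R y))\<^sup>2"
  proof -
    have yx: "(norm (y + s *\<^sub>R x))\<^sup>2 = ((norm yL)\<^sup>2 + (norm yN)\<^sup>2)
        + 2 * s * (?ip yL xL + ?ip yN xN) + s\<^sup>2 * ((norm xL)\<^sup>2 + (norm xN)\<^sup>2)"
      using norm_J_combination [of s 1] by (simp add: add.commute)
    have xy: "(norm (x + s *\<^sub>R y))\<^sup>2 = ((norm xL)\<^sup>2 + (norm xN)\<^sup>2)
        + 2 * s * (?ip yL xL + ?ip yN xN) + s\<^sup>2 * ((norm yL)\<^sup>2 + (norm yN)\<^sup>2)"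
      using norm_J_combination [of 1 s] by simp
    show ?thesis
      unfolding power_mult_distrib yx xy
      by (rule gram_inequality [OF k s k_eq \<rho>_ge_1 norm_m _ mx my]) (simp_all only: square_m square zero_le_power2)
  qed
  then show ?thesis
    by (rule power2_le_imp_le) (use k in simp)
qed

text \<open>
  The strict inequality \<open>s < 1\<close> keeps the zeros of \<open>q - s p\<close> out of the closed disc.
\<close>

lemma norm_le_k_rho_real_value:
  fixes s :: real
  assumes q: "\<forall>z\<in>cball 0 1. poly q z \<noteq> 0"
    and le: "\<And>z. z \<in> cball 0 1 \<Longrightarrow> cmod (poly p z) \<le> cmod (poly q z)"
    and s: "0 \<le> s" "s < 1" and at_0: "poly p 0 = s * poly q 0"
  shows "norm (poly_operator p A z) \<le> k_rho \<rho> s * norm (poly_operator q A z)"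
proof -
  define n where "n = p - smult s q"
  define d where "d = q - smult s p"
  let ?x = "poly_operator d A z" and ?y = "poly_operator n A z"
  have D: "0 < 1 - s\<^sup>2"
    using s by (simp add: power_less_one_iff)
  have "norm (?y + s *\<^sub>R ?x) \<le> k_rho \<rho> s * norm (?x + s *\<^sub>R ?y)"
  proof (rule moebius_norm_le)
    show "\<forall>z\<in>cball 0 1. poly d z \<noteq> 0"
    proof
      fix w :: complex
      assume w: "w \<in> cball 0 1"
      have "cmod (s * poly p w) \<le> s * cmod (poly q w)"
        using le [OF w] s by (simp add: norm_mult mult_left_mono)
      also have "\<dots> < cmod (poly q w)"
        using q w s by simp
      finally show "poly d w \<noteq> 0"
        by (auto simp: d_def)
    qed
    show "poly n 0 = 0"
      by (simp add: n_def at_0)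
    show "cmod (poly n w) \<le> cmod (poly d w)" if "cmod w = 1" for w
    proof -
      have "(cmod (poly d w))\<^sup>2 - (cmod (poly n w))\<^sup>2
          = (1 - s\<^sup>2) * ((cmod (poly q w))\<^sup>2 - (cmod (poly p w))\<^sup>2)"
        unfolding cmod_power2 by (simp add: d_def n_def power2_eq_square algebra_simps)
      moreover have "(cmod (poly p w))\<^sup>2 \<le> (cmod (poly q w))\<^sup>2"
        using le [of w] that by (intro power_mono) auto
      ultimately have "(cmod (poly n w))\<^sup>2 \<le> (cmod (poly d w))\<^sup>2"
        using D by (metis diff_ge_0_iff_ge less_imp_le mult_nonneg_nonneg)
      then show ?thesis
        by (rule power2_le_imp_le) simp
    qed
    show "1 \<le> k_rho \<rho> s"
      using k_rho_bounds [OF \<rho>_ge_1, of s] s by simp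
    show "(k_rho \<rho> s)\<^sup>2 = \<rho> * (1 - s\<^sup>2) * k_rho \<rho> s + s\<^sup>2"
      by (rule k_rho_quadratic)
  qed (use s in auto)
  moreover have "?y + s *\<^sub>R ?x = (1 - s\<^sup>2) *\<^sub>R poly_operator p A z"
  proof -
    have "n + smult s d = smult (complex_of_real (1 - s\<^sup>2)) p"
      by (simp add: n_def d_def algebra_simps power2_eq_square smult_diff_left smult_diff_right)
    then show ?thesis
      by (metis poly_operator_add poly_operator_smult scaleR_eq_scaleC)
  qed
  moreover have "?x + s *\<^sub>R ?y = (1 - s\<^sup>2) *\<^sub>R poly_operator q A z"
  proof -
    have "d + smult s n = smult (complex_of_real (1 - s\<^sup>2)) q"
      by (simp add: n_def d_def algebra_simps power2_eq_square smult_diff_left smult_diff_right)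
    then show ?thesis
      by (metis poly_operator_add poly_operator_smult scaleR_eq_scaleC)
  qed
  ultimately have "(1 - s\<^sup>2) * norm (poly_operator p A z)
      \<le> (1 - s\<^sup>2) * (k_rho \<rho> s * norm (poly_operator q A z))"
    using D by (simp add: mult.left_commute)
  then show ?thesis
    using D by simp
qed

text \<open>
  The previous bound is applied to \<open>r u f\<close> for \<open>f = p / q\<close>, with a unimodular \<open>u\<close> for which
  \<open>u f(0) \<ge> 0\<close>, and \<open>r < 1\<close> tends to \<open>1\<close>; this covers the case \<open>\<bar>f(0)\<bar> = 1\<close> too, by
  continuity of \<open>k\<^sub>\<rho>\<close>.
\<close>

lemma norm_le_k_rho:
  assumes q: "\<forall>z\<in>cball 0 1. poly q z \<noteq> 0"
    and le: "\<And>z. z \<in> cball 0 1 \<Longrightarrow> cmod (poly p z) \<le> cmod (poly q z)"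
  shows "norm (poly_operator p A z)
    \<le> k_rho \<rho> (cmod (poly p 0 / poly q 0)) * norm (poly_operator q A z)"
proof -
  define s where "s = cmod (poly p 0 / poly q 0)"
  have q0: "poly q 0 \<noteq> 0"
    using q by simp
  then have s: "0 \<le> s" "s \<le> 1"
    using le [of 0] by (auto simp: s_def norm_divide divide_le_eq)
  define a where "a = poly p 0 / poly q 0"
  define u where "u = (if a = 0 then 1 else cnj (sgn a))"
  have u: "cmod u = 1"
    by (simp add: u_def norm_sgn)
  have "a * cnj a = cmod a * cmod a"
    unfolding complex_norm_square [symmetric] power2_eq_square by simp
  then have "u * a = cmod a"
    by (auto simp: u_def sgn_eq field_simps)
  then have u_s: "u * poly p 0 = s * poly q 0"
    using q0 by (simp add: a_def s_def divide_simps)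
  have scaled: "r * norm (poly_operator p A z) \<le> k_rho \<rho> (r * s) * norm (poly_operator q A z)"
    if r: "0 < r" "r < 1" for r
  proof -
    have "norm (poly_operator (smult (r * u) p) A z) \<le> k_rho \<rho> (r * s) * norm (poly_operator q A z)"
    proof (rule norm_le_k_rho_real_value [OF q])
      show "cmod (poly (smult (r * u) p) w) \<le> cmod (poly q w)" if "w \<in> cball 0 1" for w
        using mult_mono [OF less_imp_le [OF r(2)] le [OF that]] r u by (simp add: norm_mult)
      show "0 \<le> r * s"
        using r s by simp
      show "r * s < 1"
        using mult_left_mono [OF s(2) less_imp_le [OF r(1)]] r by linarith
      show "poly (smult (r * u) p) 0 = complex_of_real (r * s) * poly q 0"
        using u_s by (simp add: mult.assoc)
    qed
    then show ?thesis
      using r u by (simp add: poly_operator_smult norm_mult)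
  qed
  have "1 * norm (poly_operator p A z) \<le> k_rho \<rho> (1 * s) * norm (poly_operator q A z)"
  proof (rule tendsto_le)
    show "((\<lambda>r. r * norm (poly_operator p A z)) \<longlongrightarrow> 1 * norm (poly_operator p A z)) (at_left 1)"
      by (intro tendsto_intros)
    show "((\<lambda>r. k_rho \<rho> (r * s) * norm (poly_operator q A z))
        \<longlongrightarrow> k_rho \<rho> (1 * s) * norm (poly_operator q A z)) (at_left 1)"
      unfolding k_rho_def by (intro tendsto_intros)
    show "\<forall>\<^sub>F r in at_left 1. r * norm (poly_operator p A z)
        \<le> k_rho \<rho> (r * s) * norm (poly_operator q A z)"
      unfolding eventually_at_left_field using scaled by (intro exI [of _ 0]) auto
  qed simp
  then show ?thesis
    by (simp add: s_def)
qed

end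

lemma rho_contraction_imp_rho_dilation:
  assumes \<rho>: "1 \<le> \<rho>" and A: "rho_contraction TYPE('k::complex_hilbert_space) \<rho> A"
  shows "\<exists>(J :: 'a::complex_hilbert_space \<Rightarrow> 'k) U. rho_dilation \<rho> A J U"
proof -
  obtain J :: "'a \<Rightarrow> 'k" and U where JU: "unitary_rho_dilation \<rho> A J U"
    and bounded: "bounded_operator A"
    using A by (auto simp: rho_contraction_def)
  then have J: "isometric_embedding J" and U: "unitary_operator U"
    and dil: "\<And>x n. 1 \<le> n \<Longrightarrow> J ((A ^^ n) x) = \<rho> *\<^sub>R orth_proj (range J) ((U ^^ n) (J x))"
    by (auto simp: unitary_rho_dilation_def)
  have lin: "clinear_map J"
    using J by (simp add: isometric_embedding_def)
  have orth: "cinner (orth_proj (range J) y) (J v) = cinner y (J v)" for y v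
  proof -
    have "cinner (y - orth_proj (range J) y) (J v) = 0"
    proof (rule orth_proj_orthogonal [OF range_isometric_embedding_closed [OF J]])
      show "0 \<in> range J"
        by (metis clinear_map_zero [OF lin] rangeI)
      show "x + y \<in> range J" if "x \<in> range J" "y \<in> range J" for x y
        using that by (auto simp flip: clinear_map_add [OF lin])
      show "c *\<^sub>C x \<in> range J" if "x \<in> range J" for c x
        using that by (auto simp flip: clinear_map_scaleC [OF lin])
    qed simp
    then show ?thesis
      by (simp add: cinner_diff_left)
  qed
  have "rho_dilation \<rho> A J U"
  proof
    fix n :: nat and x v
    assume "1 \<le> n"
    have "cinner ((A ^^ n) x) v = cinner (J ((A ^^ n) x)) (J v)"
      using J by (simp add: isometric_embedding_def)
    also have "\<dots> = \<rho> * cinner ((U ^^ n) (J x)) (J v)"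
      unfolding dil [OF \<open>1 \<le> n\<close>] by (simp add: cinner_scaleR_left orth)
    finally show "cinner ((A ^^ n) x) v = \<rho> * cinner ((U ^^ n) (J x)) (J v)" .
  qed (use \<rho> bounded J U in auto)
  then show ?thesis
    by blast
qed

text \<open>
  A supremum of reals is an upper bound only when the set is bounded above; here it is, by
  compactness of the disc.
\<close>

lemma rat_eval_bounded_by_SUP:
  assumes poles: "rat_poles f \<inter> cball 0 1 = {}" and z: "z \<in> cball 0 1"
  shows "cmod (rat_eval f z) \<le> (SUP z\<in>cball 0 1. cmod (rat_eval f z))"
proof -
  have "continuous_on (cball 0 1) (\<lambda>z. cmod (rat_eval f z))"
    unfolding rat_eval_def using poles by (intro continuous_intros) (auto simp: rat_poles_def)
  then have "bdd_above ((\<lambda>z. cmod (rat_eval f z)) ` cball 0 1)"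
    by (intro bounded_imp_bdd_above compact_imp_bounded compact_continuous_image) auto
  then show ?thesis
    using z by (rule cSUP_upper [rotated])
qed

theorem theorem3p5:
  fixes \<rho> :: real
    and A :: "'a::complex_hilbert_space \<Rightarrow> 'a"
    and f :: "complex poly fract"
  assumes "\<rho> \<ge> 1"
    and "rho_contraction TYPE('k::complex_hilbert_space) \<rho> A"
    and "rat_poles f \<inter> cball 0 1 = {}"
    and "(SUP z\<in>cball 0 1. cmod (rat_eval f z)) \<le> 1"
  shows "onorm (rat_operator f A) \<le> k_rho \<rho> (cmod (rat_eval f 0))"
proof -
  obtain J :: "'a \<Rightarrow> 'k" and U where "rho_dilation \<rho> A J U"
    using rho_contraction_imp_rho_dilation [OF assms(1,2)] by blast
  then interpret rho_dilation \<rho> A J U .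
  let ?p = "rat_num f" and ?q = "rat_denom f"
  have q: "\<forall>z\<in>cball 0 1. poly ?q z \<noteq> 0"
    using assms(3) by (auto simp: rat_poles_def)
  have le_1: "cmod (rat_eval f z) \<le> 1" if "z \<in> cball 0 1" for z
    using rat_eval_bounded_by_SUP [OF assms(3) that] assms(4) by simp
  have le: "cmod (poly ?p z) \<le> cmod (poly ?q z)" if "z \<in> cball 0 1" for z
    using le_1 [OF that] q that by (simp add: rat_eval_def norm_divide divide_le_eq)
  show ?thesis
  proof (rule onorm_bound)
    show "0 \<le> k_rho \<rho> (cmod (rat_eval f 0))"
      using k_rho_bounds [OF assms(1), of "cmod (rat_eval f 0)"] le_1 [of 0] by simp
    fix y
    have "poly_operator ?q A (inv (poly_operator ?q A) y) = y"
      by (rule surj_f_inv_f [OF poly_operator_A_surj [OF q]])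
    then show "norm (rat_operator f A y) \<le> k_rho \<rho> (cmod (rat_eval f 0)) * norm y"
      using norm_le_k_rho [OF q le, of "inv (poly_operator ?q A) y"]
      by (simp add: rat_operator_def rat_eval_def)
  qed
qed

end
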